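(* Let $\delta>0$ be fixed and let $\delta\le\lambda\le 1-\delta$. If $U$ is a random matrix in $U(N)$ distributed according to Haar measure, then $$\mathbb{P}\left\{\max_\theta|\Lambda_U(\theta)|\ge\exp(N^\lambda)\right\}=\exp\left(-\frac{N^{2\lambda}}{(1-\lambda)\log N}(1+o(1))\right)$$ as $N\to\infty$.
   Context: $U(N)$ is the group of $N\times N$ unitary matrices with normalized Haar (probability) measure. For $U\in U(N)$ with eigenvalues $e^{i\theta_1},\dots,e^{i\theta_N}$, its characteristic polynomial is $$\Lambda_U(\theta)=\det\left(I-Ue^{-i\theta}\right)=\prod_{n=1}^N\left(1-e^{i(\theta_n-\theta)}\right),$$ and the maximum is over real $\theta$. *)

theory Defs
  imports
    "HOL-Probability.Probability"
    "Jordan_Normal_Form.Schur_Decomposition"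
begin

text \<open>
  The dimension has to vary inside a statement (it tends to infinity), so matrices are those of
  Jordan_Normal_Form, whose size is a natural number and not a type.  Both that development and
  HOL-Analysis have a constant \<open>det\<close>; below it is always the former, \<open>Determinant.det\<close>.
\<close>

definition unitary_group :: "nat \<Rightarrow> complex mat set" where
  "unitary_group N =
    {U \<in> carrier_mat N N. U * mat_adjoint U = 1\<^sub>m N \<and> mat_adjoint U * U = 1\<^sub>m N}"

text \<open>
  The type of matrices carries no topology.  The Borel sigma-algebra of the unitary group, as a
  subspace of the complex matrices with the Euclidean topology, is the one pulled back along the
  entries from the finite product of the Borel sigma-algebras of the complex plane.
\<close>

definition unitary_borel :: "nat \<Rightarrow> complex mat measure" where
  "unitary_borel N =
    vimage_algebra (unitary_group N)
      (\<lambda>U. \<lambda>ij\<in>{..<N} \<times> {..<N}. U $$ ij)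
      (PiM ({..<N} \<times> {..<N}) (\<lambda>_. borel))"

definition haar_unitary :: "nat \<Rightarrow> complex mat measure \<Rightarrow> bool" where
  "haar_unitary N \<mu> \<longleftrightarrow>
    prob_space \<mu> \<and> sets \<mu> = sets (unitary_borel N) \<and>
    (\<forall>V \<in> unitary_group N. \<forall>A \<in> sets \<mu>. emeasure \<mu> ((\<lambda>U. V * U) ` A) = emeasure \<mu> A)"

definition Lambda :: "complex mat \<Rightarrow> real \<Rightarrow> complex" where
  "Lambda U \<theta> = Determinant.det (1\<^sub>m (dim_row U) - cis (- \<theta>) \<cdot>\<^sub>m U)"

definition max_Lambda :: "complex mat \<Rightarrow> real" where
  "max_Lambda U = (SUP \<theta>. cmod (Lambda U \<theta>))"

text \<open>The supremum is a maximum, by continuity and periodicity.\<close>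

lemma continuous_on_Lambda:
  assumes "U \<in> carrier_mat N N"
  shows "continuous_on A (Lambda U)"
proof -
  let ?B = "\<lambda>\<theta>. 1\<^sub>m (dim_row U) - cis (- \<theta>) \<cdot>\<^sub>m U"
  have dim: "?B \<theta> \<in> carrier_mat N N" for \<theta>
    using assms by auto
  have entry: "?B \<theta> $$ (i, p i) = (if i = p i then 1 else 0) - cis (- \<theta>) * U $$ (i, p i)"
    if "p permutes {0..<N}" "i \<in> {0..<N}" for \<theta> p i
    using that permutes_in_image[OF that(1), of i] assms by auto
  have "Lambda U = (\<lambda>\<theta>. \<Sum>p | p permutes {0..<N}. signof p *
      (\<Prod>i = 0..<N. (if i = p i then 1 else 0) - cis (- \<theta>) * U $$ (i, p i)))"
    unfolding Lambda_def det_def'[OF dim]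
    by (intro ext sum.cong refl arg_cong2[of _ _ _ _ "(*)"] prod.cong entry) auto
  moreover have "continuous_on A (\<lambda>\<theta>. \<Sum>p | p permutes {0..<N}. signof p *
      (\<Prod>i = 0..<N. (if i = p i then 1 else 0) - cis (- \<theta>) * U $$ (i, p i)))"
    by (intro continuous_intros)
  ultimately show ?thesis by simp
qed

lemma Lambda_periodic: "Lambda U (\<theta> + 2 * pi * of_int k) = Lambda U \<theta>"
proof -
  have "cis (- (\<theta> + 2 * pi * of_int k)) = cis (- \<theta>) * cis (2 * pi * of_int (- k))"
    by (simp add: cis_mult algebra_simps)
  also have "cis (2 * pi * of_int (- k)) = 1"
    by (rule cis_multiple_2pi) auto
  finally show ?thesis by (simp add: Lambda_def)
qed

lemma max_Lambda_attained:
  assumes "U \<in> carrier_mat N N"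
  obtains \<theta> where "max_Lambda U = cmod (Lambda U \<theta>)"
    and "\<And>\<theta>'. cmod (Lambda U \<theta>') \<le> cmod (Lambda U \<theta>)"
proof -
  have "continuous_on {0..2 * pi} (\<lambda>\<theta>. cmod (Lambda U \<theta>))"
    by (intro continuous_on_norm continuous_on_Lambda[OF assms])
  then have "\<exists>\<theta>\<in>{0..2 * pi}. \<forall>x\<in>{0..2 * pi}. cmod (Lambda U x) \<le> cmod (Lambda U \<theta>)"
    by (intro continuous_attains_sup) auto
  then obtain \<theta> where \<theta>: "\<forall>x\<in>{0..2 * pi}. cmod (Lambda U x) \<le> cmod (Lambda U \<theta>)"
    by blast
  have le: "cmod (Lambda U x) \<le> cmod (Lambda U \<theta>)" for x
  proof -
    define k where "k = \<lfloor>x / (2 * pi)\<rfloor>"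
    have "of_int k \<le> x / (2 * pi)" "x / (2 * pi) < of_int k + 1"
      unfolding k_def by linarith+
    then have "x - 2 * pi * of_int k \<in> {0..2 * pi}"
      by (auto simp: field_simps)
    moreover have "Lambda U (x - 2 * pi * of_int k) = Lambda U x"
      using Lambda_periodic[of U x "- k"] by simp
    ultimately show ?thesis using \<theta> by metis
  qed
  have "max_Lambda U = cmod (Lambda U \<theta>)"
    unfolding max_Lambda_def
    by (rule cSup_eq_maximum) (use le in auto)
  with le that show thesis by blast
qed

end

theory Submission
  imports Defs "HOL-Real_Asymp.Real_Asymp"
begin

text \<open>
  Left invariance gives \<open>E |det (W - U)|\<^sup>2\<^sup>k = E |det (1 - U)|\<^sup>2\<^sup>k\<close> for every unitary \<open>W\<close>.  Averaging
  over \<open>W = 1 \<oplus> V\<close> with \<open>V\<close> Haar distributed of size \<open>N - 1\<close> and taking a Schur complement, one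
  finds that the moment of size \<open>N\<close> is \<open>E |1 - U $$ (0, 0)|\<^sup>2\<^sup>k\<close> times the moment of size \<open>N - 1\<close>.
  The entry of a Haar unitary has explicit moments, because its law does not change under plane
  rotations of the first column.  So the moment is a product which is \<open>exp (k\<^sup>2 (ln (N / k) + O(1)))\<close>
  for \<open>2 k \<le> N\<close>.

  The upper bound is Markov's inequality for the optimal \<open>k\<close>: by Parseval and Cauchy-Schwarz, the maximum
  of \<open>|\<Lambda>|\<^sup>2\<^sup>k\<close> is at most its sum over the \<open>k N + 1\<close>-th roots of unity.  For the lower bound it
  is enough to look at \<open>\<theta> = 0\<close>: under the measure with density proportional to \<open>|\<Lambda>|\<^sup>2\<^sup>k\<close>,
  with \<open>k\<close> slightly above the optimum, \<open>ln |\<Lambda>|\<close> concentrates just above the level \<open>N\<^sup>\<lambda>\<close>.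
\<close>

section \<open>Parseval's identity for roots of unity\<close>

text \<open>Expanding the square gives a double sum over \<open>m\<close> and \<open>n\<close>; the
  inner sum over \<open>j\<close> is geometric and vanishes unless \<open>m = n\<close>, because
  exponents below \<open>D\<close> give distinct roots of unity. It serves twice to average a
  binomial expansion over phases and once to bound a polynomial on the circle.\<close>

lemma sum_root_of_unity_norm_square:
  fixes c :: "nat \<Rightarrow> complex"
  assumes "D > 0"
  shows "(\<Sum>j<D. (cmod (\<Sum>m<D. c m * cis (2 * pi * real j / real D) ^ m))\<^sup>2) =
    real D * (\<Sum>m<D. (cmod (c m))\<^sup>2)"
proof -
  define w where "w j = cis (2 * pi * real j / real D)" for j :: nat
  \<comment> \<open>Exchanging index and exponent turns each sum over the sample points
    \<open>j\<close> into a geometric series.\<close>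
  have w_pow: "w j ^ m = w m ^ j" for j m
    unfolding w_def Complex.DeMoivre by (rule arg_cong[of _ _ cis]) (simp add: field_simps)
  have w_D: "w m ^ D = 1" for m
  proof -
    have "real D * (2 * pi * real m / real D) = 2 * pi * real m" using assms by simp
    then show ?thesis unfolding w_def Complex.DeMoivre by (simp add: cis_multiple_2pi)
  qed
  have w_norm: "cnj (w m) * w m = 1" "cmod (w m) = 1" for m
    by (simp_all add: w_def cis_cnj cis_mult)
  have orth: "(\<Sum>j<D. w m ^ j * cnj (w n ^ j)) = (if m = n then of_nat D else 0)"
    if "m < D" "n < D" for m n
  proof -
    define r where "r = w m * cnj (w n)"
    have eq: "(\<Sum>j<D. w m ^ j * cnj (w n ^ j)) = (\<Sum>j<D. r ^ j)"
      by (simp add: r_def power_mult_distrib)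
    show ?thesis
    proof (cases "m = n")
      case True
      then have "r = 1" using w_norm(1)[of n] by (simp add: r_def mult.commute)
      with True eq show ?thesis by simp
    next
      case False
      have "r \<noteq> 1"
      proof
        assume "r = 1"
        then have "w m * cnj (w n) * w n = w n" by (simp add: r_def)
        then have "w m = w n" using w_norm(1)[of n] by (simp add: mult.assoc)
        moreover have "w k = exp (2 * of_real pi * \<i> * of_nat k / of_nat D)" for k
          by (simp add: w_def cis_conv_exp mult_ac)
        ultimately have "m mod D = n mod D"
          using complex_root_unity_eq[of D m n] assms by simp
        with that False show False by simp
      qed
      moreover have "r ^ D = 1" by (simp add: r_def power_mult_distrib w_D flip: complex_cnj_power)
      ultimately have "(\<Sum>j<D. r ^ j) = 0" by (simp add: sum_gp_strict)
      with False eq show ?thesis by simp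
    qed
  qed
  have sq: "complex_of_real ((cmod z)\<^sup>2) = z * cnj z" for z
    by (rule complex_norm_square)
  have "complex_of_real (\<Sum>j<D. (cmod (\<Sum>m<D. c m * w j ^ m))\<^sup>2) =
      (\<Sum>j<D. \<Sum>m<D. \<Sum>n<D. c m * cnj (c n) * (w m ^ j * cnj (w n ^ j)))"
  proof -
    have "complex_of_real ((cmod (\<Sum>m<D. c m * w j ^ m))\<^sup>2) =
        (\<Sum>m<D. \<Sum>n<D. c m * cnj (c n) * (w m ^ j * cnj (w n ^ j)))" for j
      unfolding sq cnj_sum sum_product w_pow[of j]
      by (intro sum.cong refl) (simp only: complex_cnj_mult mult_ac)
    then show ?thesis unfolding of_real_sum by simp
  qed
  also have "\<dots> = (\<Sum>m<D. \<Sum>j<D. \<Sum>n<D. c m * cnj (c n) * (w m ^ j * cnj (w n ^ j)))"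
    by (rule sum.swap)
  also have "\<dots> = (\<Sum>m<D. \<Sum>n<D. \<Sum>j<D. c m * cnj (c n) * (w m ^ j * cnj (w n ^ j)))"
    by (intro sum.cong refl sum.swap)
  also have "\<dots> = (\<Sum>m<D. \<Sum>n<D. if m = n then c m * cnj (c n) * of_nat D else 0)"
    unfolding sum_distrib_left[symmetric] by (intro sum.cong refl) (simp add: orth del: complex_cnj_power)
  also have "\<dots> = complex_of_real (real D * (\<Sum>m<D. (cmod (c m))\<^sup>2))"
    unfolding of_real_mult of_real_sum sq by (simp add: sum_distrib_left mult_ac)
  finally show ?thesis unfolding w_def of_real_eq_iff .
qed

section \<open>The unitary group\<close>

lemma mat_adjoint_carrier: "U \<in> carrier_mat n m \<Longrightarrow> mat_adjoint U \<in> carrier_mat m n"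
  by (auto simp: mat_adjoint_def)

lemma mat_adjoint_index:
  "U \<in> carrier_mat n m \<Longrightarrow> i < m \<Longrightarrow> j < n \<Longrightarrow> mat_adjoint U $$ (i, j) = cnj (U $$ (j, i))"
  by (auto simp: mat_adjoint_def mat_of_rows_index conjugate_complex_def)

lemma mat_adjoint_adjoint: "U \<in> carrier_mat n m \<Longrightarrow> mat_adjoint (mat_adjoint U) = (U :: complex mat)"
  using mat_adjoint_carrier[of U n m] mat_adjoint_carrier[of "mat_adjoint U" m n]
  by (intro eq_matI) (simp_all add: mat_adjoint_index[of "mat_adjoint U" m n] mat_adjoint_index[of U n m] carrier_matD)

lemma mult_index_sum:
  "A \<in> carrier_mat n m \<Longrightarrow> B \<in> carrier_mat m l \<Longrightarrow> i < n \<Longrightarrow> j < l \<Longrightarrow>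
    (A * B) $$ (i, j) = (\<Sum>k<m. A $$ (i, k) * B $$ (k, j))"
  by (auto simp: scalar_prod_def atLeast0LessThan intro!: sum.cong)

text \<open>Orthonormal columns give a left inverse, which for square matrices is also a right
  inverse; so unitarity reduces to column sums.\<close>

lemma unitary_groupI:
  assumes "U \<in> carrier_mat N N"
    and "\<And>i j. i < N \<Longrightarrow> j < N \<Longrightarrow> (\<Sum>k<N. cnj (U $$ (k, i)) * U $$ (k, j)) = (if i = j then 1 else 0)"
  shows "U \<in> unitary_group N"
proof -
  note ad = mat_adjoint_carrier[OF assms(1)]
  have "mat_adjoint U * U = 1\<^sub>m N"
  proof (rule eq_matI)
    fix i j assume "i < dim_row (1\<^sub>m N :: complex mat)" "j < dim_col (1\<^sub>m N :: complex mat)"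
    then have ij: "i < N" "j < N" by auto
    have "(mat_adjoint U * U) $$ (i, j) = (\<Sum>k<N. mat_adjoint U $$ (i, k) * U $$ (k, j))"
      by (rule mult_index_sum[OF ad assms(1) ij])
    also have "\<dots> = (\<Sum>k<N. cnj (U $$ (k, i)) * U $$ (k, j))"
      using mat_adjoint_index[OF assms(1)] ij by (intro sum.cong) auto
    finally show "(mat_adjoint U * U) $$ (i, j) = 1\<^sub>m N $$ (i, j)"
      using assms(2) ij by simp
  qed (use assms(1) ad in auto)
  with mat_mult_left_right_inverse[OF ad assms(1)] show ?thesis
    using assms(1) by (simp add: unitary_group_def)
qed

lemma unitary_group_carrier: "U \<in> unitary_group N \<Longrightarrow> U \<in> carrier_mat N N"
  by (simp add: unitary_group_def)

lemma unitary_group_cols: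
  assumes "U \<in> unitary_group N" "i < N" "j < N"
  shows "(\<Sum>k<N. cnj (U $$ (k, i)) * U $$ (k, j)) = (if i = j then 1 else 0)"
proof -
  note C = unitary_group_carrier[OF assms(1)]
  have "(mat_adjoint U * U) $$ (i, j) = (\<Sum>k<N. mat_adjoint U $$ (i, k) * U $$ (k, j))"
    by (rule mult_index_sum[OF mat_adjoint_carrier[OF C] C assms(2,3)])
  also have "\<dots> = (\<Sum>k<N. cnj (U $$ (k, i)) * U $$ (k, j))"
    using mat_adjoint_index[OF C] assms by (intro sum.cong) auto
  finally show ?thesis using assms by (simp add: unitary_group_def)
qed

lemma unitary_group_col_norm:
  assumes "U \<in> unitary_group N" "j < N"
  shows "(\<Sum>k<N. (cmod (U $$ (k, j)))\<^sup>2) = 1"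
proof -
  have "complex_of_real (\<Sum>k<N. (cmod (U $$ (k, j)))\<^sup>2) = (\<Sum>k<N. cnj (U $$ (k, j)) * U $$ (k, j))"
    unfolding of_real_sum by (intro sum.cong refl) (simp only: complex_norm_square mult.commute)
  also have "\<dots> = 1" using unitary_group_cols[OF assms(1,2,2)] by simp
  finally show ?thesis by (metis of_real_eq_1_iff)
qed

lemma unitary_group_entry_le:
  assumes "U \<in> unitary_group N" "i < N" "j < N"
  shows "cmod (U $$ (i, j)) \<le> 1"
proof -
  have "(cmod (U $$ (i, j)))\<^sup>2 \<le> (\<Sum>k<N. (cmod (U $$ (k, j)))\<^sup>2)"
    using assms by (intro member_le_sum) auto
  with unitary_group_col_norm[OF assms(1,3)] show ?thesis
    by (simp add: power_le_one_iff)
qed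

lemma unitary_group_adjoint:
  assumes "U \<in> unitary_group N"
  shows "mat_adjoint U \<in> unitary_group N"
  using assms mat_adjoint_adjoint[OF unitary_group_carrier[OF assms]] mat_adjoint_carrier[of U N N]
  by (simp add: unitary_group_def)

lemma unitary_group_mult:
  assumes V: "V \<in> unitary_group N" and U: "U \<in> unitary_group N"
  shows "V * U \<in> unitary_group N"
proof -
  note C = unitary_group_carrier[OF V] unitary_group_carrier[OF U]
  note A = mat_adjoint_carrier[OF C(1)] mat_adjoint_carrier[OF C(2)]
  have VU: "V * U \<in> carrier_mat N N" using C by auto
  have "mat_adjoint (V * U) = mat_adjoint U * mat_adjoint V"
  proof (rule eq_matI)
    fix i j assume "i < dim_row (mat_adjoint U * mat_adjoint V)" "j < dim_col (mat_adjoint U * mat_adjoint V)"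
    then have ij: "i < N" "j < N" using A by auto
    have "(mat_adjoint U * mat_adjoint V) $$ (i, j) = (\<Sum>k<N. mat_adjoint U $$ (i, k) * mat_adjoint V $$ (k, j))"
      by (rule mult_index_sum[OF A(2,1) ij])
    also have "\<dots> = (\<Sum>k<N. cnj (V $$ (j, k) * U $$ (k, i)))"
      using ij by (intro sum.cong) (auto simp: mat_adjoint_index[OF C(1)] mat_adjoint_index[OF C(2)])
    also have "\<dots> = mat_adjoint (V * U) $$ (i, j)"
      using ij by (simp only: mat_adjoint_index[OF VU] mult_index_sum[OF C] cnj_sum)
    finally show "mat_adjoint (V * U) $$ (i, j) = (mat_adjoint U * mat_adjoint V) $$ (i, j)" ..
  qed (use A mat_adjoint_carrier[OF VU] in auto)
  moreover have "mat_adjoint U * mat_adjoint V * (V * U) = mat_adjoint U * (mat_adjoint V * (V * U))"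
    by (rule assoc_mult_mat[OF A(2,1) VU])
  moreover have "mat_adjoint V * (V * U) = mat_adjoint V * V * U"
    by (rule assoc_mult_mat[OF A(1) C, symmetric])
  moreover have "mat_adjoint V * V = 1\<^sub>m N" "mat_adjoint U * U = 1\<^sub>m N"
    using U V by (simp_all add: unitary_group_def)
  ultimately have "mat_adjoint (V * U) * (V * U) = 1\<^sub>m N"
    using left_mult_one_mat[OF C(2)] by simp
  moreover have "mat_adjoint (V * U) \<in> carrier_mat N N" by (rule mat_adjoint_carrier[OF VU])
  ultimately show ?thesis
    using mat_mult_left_right_inverse[OF _ VU] VU by (simp add: unitary_group_def)
qed

lemma one_unitary_group: "1\<^sub>m N \<in> unitary_group N"
  by (rule unitary_groupI) (auto simp: sum.delta if_distrib cong: if_cong)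

lemma cis_unitary_group: "cis t \<cdot>\<^sub>m 1\<^sub>m N \<in> unitary_group N"
  by (rule unitary_groupI) (auto simp: sum.delta if_distrib cis_cnj cis_mult cong: if_cong)

lemma cmod_det_unitary:
  assumes "U \<in> unitary_group N"
  shows "cmod (Determinant.det U) = 1"
proof -
  note C = unitary_group_carrier[OF assms]
  note A = mat_adjoint_carrier[OF C]
  have "transpose_mat (mat_adjoint U) = map_mat cnj U"
    using C A by (intro eq_matI) (auto simp: mat_adjoint_index[OF C])
  then have "Determinant.det (mat_adjoint U) = Determinant.det (map_mat cnj U)"
    using det_transpose[OF A] by simp
  also have "\<dots> = cnj (Determinant.det U)"
  proof -
    interpret comm_ring_hom cnj by unfold_locales auto
    show ?thesis by (rule hom_det)
  qed
  finally have "Determinant.det U * cnj (Determinant.det U) = 1"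
    using det_mult[OF C A] assms by (simp add: unitary_group_def)
  then have "(cmod (Determinant.det U))\<^sup>2 = 1"
    by (metis complex_norm_square of_real_eq_1_iff)
  then show ?thesis by (simp add: power2_eq_1_iff) (metis norm_ge_zero not_one_le_zero neg_0_le_iff_le)
qed

section \<open>Plane rotations\<close>

text \<open>The rotation of the plane of coordinates \<open>0\<close> and \<open>i\<close>. The
  diagonal entry is real and the phase sits in \<open>b\<close>: replacing \<open>b\<close> by
  \<open>- b\<close> gives the adjoint, and the phase of \<open>b\<close> can be averaged over roots
  of unity.\<close>

definition givens :: "nat \<Rightarrow> nat \<Rightarrow> real \<Rightarrow> complex \<Rightarrow> complex mat" where
  "givens N i x b = mat N N (\<lambda>(j, k).
    if j = 0 then (if k = 0 then of_real x else if k = i then b else 0)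
    else if j = i then (if k = 0 then - cnj b else if k = i then of_real x else 0)
    else if j = k then 1 else 0)"

lemma givens_carrier: "givens N i x b \<in> carrier_mat N N"
  by (simp add: givens_def)

lemma givens_sum:
  assumes "0 < i" "i < N" "j < N"
  shows "(\<Sum>k<N. givens N i x b $$ (j, k) * g k) =
    (if j = 0 then of_real x * g 0 + b * g i
     else if j = i then - cnj b * g 0 + of_real x * g i else g j)"
proof -
  have two: "(\<Sum>k<N. (if k = 0 then p else if k = i then q else 0) * g k) = p * g 0 + q * g i" for p q
  proof -
    have "(\<Sum>k<N. (if k = 0 then p else if k = i then q else 0) * g k) =
        (\<Sum>k\<in>{0, i}. (if k = 0 then p else if k = i then q else 0) * g k)"
      using assms by (intro sum.mono_neutral_right) auto
    with assms show ?thesis by simp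
  qed
  have one: "(\<Sum>k<N. (if j = k then 1 else 0) * g k) = g j"
  proof -
    have "(\<Sum>k<N. (if j = k then 1 else 0) * g k) = (\<Sum>k<N. if j = k then g k else 0)"
      by (intro sum.cong) auto
    with assms show ?thesis by simp
  qed
  have "(\<Sum>k<N. givens N i x b $$ (j, k) * g k) = (\<Sum>k<N.
      (if j = 0 then (if k = 0 then of_real x else if k = i then b else 0)
       else if j = i then (if k = 0 then - cnj b else if k = i then of_real x else 0)
       else if j = k then 1 else 0) * g k)"
    using assms by (intro sum.cong refl) (simp add: givens_def)
  also have "\<dots> = (if j = 0 then of_real x * g 0 + b * g i
     else if j = i then - cnj b * g 0 + of_real x * g i else g j)"
    using two one by simp
  finally show ?thesis .
qed

lemma givens_adjoint:
  assumes "0 < i" "i < N"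
  shows "mat_adjoint (givens N i x b) = givens N i x (- b)"
proof (rule eq_matI)
  fix j l assume "j < dim_row (givens N i x (- b))" "l < dim_col (givens N i x (- b))"
  then have jl: "j < N" "l < N" by (auto simp: givens_def)
  show "mat_adjoint (givens N i x b) $$ (j, l) = givens N i x (- b) $$ (j, l)"
    unfolding mat_adjoint_index[OF givens_carrier jl] using jl assms by (auto simp: givens_def)
qed (use mat_adjoint_carrier[OF givens_carrier, of N i x b] in \<open>auto simp: givens_def\<close>)

lemma givens_unitary:
  assumes "0 < i" "i < N" "x\<^sup>2 + (cmod b)\<^sup>2 = 1"
  shows "givens N i x b \<in> unitary_group N"
proof -
  have sq: "of_real x * of_real x + b * cnj b = 1"
  proof -
    have "(cmod b)\<^sup>2 = 1 - x\<^sup>2" using assms(3) by simp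
    then have "b * cnj b = of_real (1 - x\<^sup>2)" using complex_norm_square[of b] by metis
    then show ?thesis by (simp add: power2_eq_square)
  qed
  have "givens N i x b * givens N i x (- b) = 1\<^sub>m N"
  proof (rule eq_matI)
    fix j l assume "j < dim_row (1\<^sub>m N :: complex mat)" "l < dim_col (1\<^sub>m N :: complex mat)"
    then have jl: "j < N" "l < N" by auto
    show "(givens N i x b * givens N i x (- b)) $$ (j, l) = 1\<^sub>m N $$ (j, l)"
      unfolding mult_index_sum[OF givens_carrier givens_carrier jl] givens_sum[OF assms(1,2) jl(1)]
      using jl assms(1,2) sq by (auto simp: givens_def algebra_simps)
  qed (auto simp: givens_def)
  then show ?thesis
    using mat_mult_left_right_inverse[OF givens_carrier givens_carrier, of N i x b i x "- b"]
    by (simp add: unitary_group_def givens_carrier givens_adjoint[OF assms(1,2)])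
qed

lemma givens_mult_00:
  assumes "0 < i" "i < N" "U \<in> carrier_mat N N"
  shows "(givens N i x b * U) $$ (0, 0) = of_real x * U $$ (0, 0) + b * U $$ (i, 0)"
proof -
  have "0 < N" using assms by simp
  then show ?thesis
    unfolding mult_index_sum[OF givens_carrier assms(3) \<open>0 < N\<close> \<open>0 < N\<close>] using givens_sum[OF assms(1,2) \<open>0 < N\<close>] by simp
qed

section \<open>The embedding of U(n) into U(n+1) and Schur complements\<close>

definition corner_one :: "nat \<Rightarrow> complex mat \<Rightarrow> complex mat" where
  "corner_one n V = four_block_mat (1\<^sub>m 1) (0\<^sub>m 1 n) (0\<^sub>m n 1) V"

lemma corner_one_carrier: "V \<in> carrier_mat n n \<Longrightarrow> corner_one n V \<in> carrier_mat (Suc n) (Suc n)"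
  unfolding corner_one_def by auto

lemma corner_one_index:
  assumes "V \<in> carrier_mat n n" "i < Suc n" "j < Suc n"
  shows "corner_one n V $$ (i, j) =
    (if i = 0 \<or> j = 0 then (if i = j then 1 else 0) else V $$ (i - 1, j - 1))"
  using assms by (auto simp: corner_one_def)

lemma corner_one_unitary:
  assumes "V \<in> unitary_group n"
  shows "corner_one n V \<in> unitary_group (Suc n)"
proof (rule unitary_groupI)
  note C = unitary_group_carrier[OF assms]
  show "corner_one n V \<in> carrier_mat (Suc n) (Suc n)" by (rule corner_one_carrier[OF C])
  fix i j assume ij: "i < Suc n" "j < Suc n"
  have "(\<Sum>k<Suc n. cnj (corner_one n V $$ (k, i)) * corner_one n V $$ (k, j)) =
      (if i = 0 \<and> j = 0 then 1 else 0) + (\<Sum>k<n. if i = 0 \<or> j = 0 then 0 else cnj (V $$ (k, i - 1)) * V $$ (k, j - 1))"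
    unfolding sum.lessThan_Suc_shift
    using ij by (intro arg_cong2[of _ _ _ _ "(+)"] sum.cong refl) (auto simp: corner_one_index[OF C])
  also have "\<dots> = (if i = j then 1 else 0)"
    using ij unitary_group_cols[OF assms, of "i - 1" "j - 1"] by (cases i; cases j) auto
  finally show "(\<Sum>k<Suc n. cnj (corner_one n V $$ (k, i)) * corner_one n V $$ (k, j)) =
      (if i = j then 1 else 0)" .
qed

text \<open>
  If \<open>U (t, x) = (t, y)\<close>, then \<open>y\<close> is determined by \<open>x\<close>, provided that \<open>U $$ (0, 0) \<noteq> 1\<close>, and the
  map \<open>x \<mapsto> y\<close> is an isometry.  Its matrix is the Schur complement below.
\<close>

definition feedback :: "nat \<Rightarrow> complex mat \<Rightarrow> complex mat" where
  "feedback n U = mat n n (\<lambda>(i, j).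
    U $$ (Suc i, Suc j) + U $$ (Suc i, 0) * U $$ (0, Suc j) / (1 - U $$ (0, 0)))"

lemma feedback_unitary:
  assumes U: "U \<in> unitary_group (Suc n)" and a: "U $$ (0, 0) \<noteq> 1"
  shows "feedback n U \<in> unitary_group n"
proof (rule unitary_groupI)
  show "feedback n U \<in> carrier_mat n n" by (simp add: feedback_def)
  fix i j assume ij: "i < n" "j < n"
  define a where "a = U $$ (0, 0)"
  define g where "g = 1 / (1 - a)"
  define r where "r j = U $$ (0, Suc j)" for j
  define c where "c k = U $$ (Suc k, 0)" for k
  define d where "d k j = U $$ (Suc k, Suc j)" for k j
  \<comment> \<open>This relation and its conjugate eliminate \<open>a\<close> at the end, where the
    bracket multiplying \<open>cnj (r i) * r j\<close> then vanishes identically.\<close>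
  have ag: "a * g = g - 1" using assms(2) by (simp add: g_def a_def field_simps)
  then have ag': "cnj a * cnj g = cnj g - 1" by (metis complex_cnj_mult complex_cnj_diff complex_cnj_one)
  \<comment> \<open>Orthonormality of the columns of \<open>U\<close>, with the contribution of row
    \<open>0\<close> moved to the right.\<close>
  have S: "(\<Sum>k<n. cnj (d k i) * d k j) = (if i = j then 1 else 0) - cnj (r i) * r j"
    "(\<Sum>k<n. cnj (d k i) * c k) = - cnj (r i) * a"
    "(\<Sum>k<n. cnj (c k) * d k j) = - cnj a * r j"
    "(\<Sum>k<n. cnj (c k) * c k) = 1 - cnj a * a"
    using unitary_group_cols[OF U, of "Suc i" "Suc j"] unitary_group_cols[OF U, of "Suc i" 0]
      unitary_group_cols[OF U, of 0 "Suc j"] unitary_group_cols[OF U, of 0 0] ij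
    unfolding sum.lessThan_Suc_shift a_def r_def c_def d_def by (auto simp: algebra_simps eq_neg_iff_add_eq_0)
  have "(\<Sum>k<n. cnj (feedback n U $$ (k, i)) * feedback n U $$ (k, j)) =
      (\<Sum>k<n. cnj (d k i) * d k j + (g * r j) * (cnj (d k i) * c k) +
        (cnj g * cnj (r i)) * (cnj (c k) * d k j) + (cnj g * cnj (r i) * g * r j) * (cnj (c k) * c k))"
  proof (intro sum.cong refl)
    fix k assume "k \<in> {..<n}"
    then have fb: "feedback n U $$ (k, l) = d k l + c k * r l * g" if "l < n" for l
      using that by (simp add: feedback_def a_def g_def r_def c_def d_def)
    show "cnj (feedback n U $$ (k, i)) * feedback n U $$ (k, j) = cnj (d k i) * d k j + (g * r j) * (cnj (d k i) * c k) +
        (cnj g * cnj (r i)) * (cnj (c k) * d k j) + (cnj g * cnj (r i) * g * r j) * (cnj (c k) * c k)"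
      unfolding fb[OF ij(1)] fb[OF ij(2)] by (simp add: algebra_simps)
  qed
  also have "\<dots> = (if i = j then 1 else 0) - cnj (r i) * r j + (g * r j) * (- cnj (r i) * a) +
      (cnj g * cnj (r i)) * (- cnj a * r j) + (cnj g * cnj (r i) * g * r j) * (1 - cnj a * a)"
    unfolding sum.distrib sum_distrib_left[symmetric] S ..
  also have "\<dots> = (if i = j then 1 else 0) + cnj (r i) * r j *
      (- 1 - a * g - cnj a * cnj g + g * cnj g - (a * g) * (cnj a * cnj g))"
    by (simp add: algebra_simps)
  also have "\<dots> = (if i = j then 1 else 0)"
    unfolding ag ag' by (simp add: algebra_simps)
  finally show "(\<Sum>k<n. cnj (feedback n U $$ (k, i)) * feedback n U $$ (k, j)) = (if i = j then 1 else 0)" .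
qed

text \<open>One step of block Gaussian elimination: the difference is a unit lower triangular matrix
  times a block upper triangular one, whose lower right block is the Schur complement of
  \<open>1 - U $$ (0, 0)\<close>, namely \<open>V - feedback n U\<close>.\<close>

lemma det_corner_one_diff:
  assumes U: "U \<in> carrier_mat (Suc n) (Suc n)" and V: "V \<in> carrier_mat n n" and a: "U $$ (0, 0) \<noteq> 1"
  shows "Determinant.det (corner_one n V - U) = (1 - U $$ (0, 0)) * Determinant.det (V - feedback n U)"
proof -
  define A where "A = mat 1 1 (\<lambda>_. 1 - U $$ (0, 0))"
  define R where "R = mat 1 n (\<lambda>(i, j). - U $$ (0, Suc j))"
  define C where "C = mat n 1 (\<lambda>(i, j). - U $$ (Suc i, 0) / (1 - U $$ (0, 0)))"
  let ?L = "four_block_mat (1\<^sub>m 1) (0\<^sub>m 1 n) C (1\<^sub>m n)"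
  let ?T = "four_block_mat A R (0\<^sub>m n 1) (V - feedback n U)"
  have car: "A \<in> carrier_mat 1 1" "R \<in> carrier_mat 1 n" "C \<in> carrier_mat n 1"
    "feedback n U \<in> carrier_mat n n" "V - feedback n U \<in> carrier_mat n n"
    using V by (auto simp: A_def R_def C_def feedback_def)
  have LT: "?L * ?T = four_block_mat A R (C * A) (C * R + (V - feedback n U))"
    using car by (subst mult_four_block_mat[of _ 1 1 _ n _ n _ _ 1 _ n]) auto
  have "corner_one n V - U = ?L * ?T"
    unfolding LT
  proof (rule eq_matI)
    fix i j assume "i < dim_row (four_block_mat A R (C * A) (C * R + (V - feedback n U)))"
      "j < dim_col (four_block_mat A R (C * A) (C * R + (V - feedback n U)))"
    then have ij: "i < Suc n" "j < Suc n" using car by auto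
    have one_pos: "0 < (1 :: nat)" by simp
    have CA: "(C * A) $$ (k, 0) = - U $$ (Suc k, 0)" if "k < n" for k
      using that a unfolding mult_index_sum[OF car(3,1) that one_pos] by (simp add: A_def C_def)
    have CR: "(C * R) $$ (k, l) = U $$ (Suc k, 0) * U $$ (0, Suc l) / (1 - U $$ (0, 0))" if "k < n" "l < n" for k l
      using that unfolding mult_index_sum[OF car(3,2) that] by (simp add: R_def C_def)
    have eq: "(corner_one n V - U) $$ (i, j) = corner_one n V $$ (i, j) - U $$ (i, j)"
      using ij U by auto
    show "(corner_one n V - U) $$ (i, j) = four_block_mat A R (C * A) (C * R + (V - feedback n U)) $$ (i, j)"
      unfolding eq corner_one_index[OF V ij]
      using ij car V CA CR by (cases i; cases j) (auto simp: A_def R_def feedback_def)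
  qed (use car U in auto)
  also have "Determinant.det \<dots> = Determinant.det ?L * Determinant.det ?T"
    using car by (intro det_mult[of _ "Suc n"]) auto
  also have "Determinant.det ?L = 1"
    using car by (subst det_four_block_mat_upper_right_zero[of _ 1 _ n]) auto
  also have "Determinant.det ?T = (1 - U $$ (0, 0)) * Determinant.det (V - feedback n U)"
    using car by (subst det_four_block_mat_lower_left_zero[of _ 1 _ n]) (auto simp: det_single A_def)
  finally show ?thesis by simp
qed

text \<open>A column of norm one with first entry \<open>1\<close> has no other nonzero entry, so
  the first column of the difference is zero.\<close>

lemma det_corner_one_diff_zero:
  assumes U: "U \<in> unitary_group (Suc n)" and V: "V \<in> carrier_mat n n" and a: "U $$ (0, 0) = 1"
  shows "Determinant.det (corner_one n V - U) = 0"
proof -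
  note C = unitary_group_carrier[OF U]
  have "(\<Sum>k<n. (cmod (U $$ (Suc k, 0)))\<^sup>2) = 0"
    using unitary_group_col_norm[OF U, of 0] a unfolding sum.lessThan_Suc_shift by simp
  then have z: "U $$ (Suc k, 0) = 0" if "k < n" for k
    using that by (subst (asm) sum_nonneg_eq_0_iff) auto
  define R where "R = mat 1 n (\<lambda>(i, j). - U $$ (0, Suc j))"
  define D where "D = mat n n (\<lambda>(i, j). V $$ (i, j) - U $$ (Suc i, Suc j))"
  have "corner_one n V - U = four_block_mat (0\<^sub>m 1 1) R (0\<^sub>m n 1) D"
  proof (rule eq_matI)
    fix i j assume "i < dim_row (four_block_mat (0\<^sub>m 1 1) R (0\<^sub>m n 1) D)"
      "j < dim_col (four_block_mat (0\<^sub>m 1 1) R (0\<^sub>m n 1) D)"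
    then have ij: "i < Suc n" "j < Suc n" by (auto simp: D_def)
    have eq: "(corner_one n V - U) $$ (i, j) = corner_one n V $$ (i, j) - U $$ (i, j)"
      using ij C by auto
    show "(corner_one n V - U) $$ (i, j) = four_block_mat (0\<^sub>m 1 1) R (0\<^sub>m n 1) D $$ (i, j)"
      unfolding eq corner_one_index[OF V ij]
      using ij V z a by (cases i; cases j) (auto simp: R_def D_def)
  qed (use C in \<open>auto simp: D_def\<close>)
  also have "Determinant.det \<dots> = Determinant.det (0\<^sub>m 1 1 :: complex mat) * Determinant.det D"
    by (rule det_four_block_mat_lower_left_zero) (auto simp: R_def D_def)
  finally show ?thesis by (simp add: det_single)
qed

text \<open>Merges the two cases: where the corner entry is \<open>1\<close> both sides vanish and
  the identity serves as \<open>U'\<close>. What matters is that \<open>U'\<close> depends on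
  \<open>U\<close> alone, so that \<open>V\<close> can be integrated out with \<open>U\<close>
  fixed.\<close>

lemma corner_one_diff_obtain:
  assumes U: "U \<in> unitary_group (Suc n)"
  obtains U' where "U' \<in> unitary_group n"
    "\<And>V. V \<in> unitary_group n \<Longrightarrow>
      Determinant.det (corner_one n V - U) = (1 - U $$ (0, 0)) * Determinant.det (V - U')"
proof (cases "U $$ (0, 0) = 1")
  case True
  with that[OF one_unitary_group] show thesis
    using det_corner_one_diff_zero[OF U] unitary_group_carrier by auto
next
  case False
  with that[OF feedback_unitary[OF U]] show thesis
    using det_corner_one_diff[OF unitary_group_carrier[OF U]] unitary_group_carrier by auto
qed

section \<open>Moments under Haar measure\<close>

lemma borel_measurable_det:
  fixes A :: "'a \<Rightarrow> complex mat"
  assumes "\<And>x. x \<in> space M \<Longrightarrow> A x \<in> carrier_mat n n"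
    and "\<And>i j. i < n \<Longrightarrow> j < n \<Longrightarrow> (\<lambda>x. A x $$ (i, j)) \<in> borel_measurable M"
  shows "(\<lambda>x. Determinant.det (A x)) \<in> borel_measurable M"
proof -
  have "(\<lambda>x. \<Sum>p | p permutes {0..<n}. signof p * (\<Prod>i = 0..<n. A x $$ (i, p i))) \<in> borel_measurable M"
    by (intro borel_measurable_sum borel_measurable_times borel_measurable_const borel_measurable_prod assms(2))
      (auto dest: permutes_in_image)
  moreover have "Determinant.det (A x) = (\<Sum>p | p permutes {0..<n}. signof p * (\<Prod>i = 0..<n. A x $$ (i, p i)))"
    if "x \<in> space M" for x
    by (rule det_def'[OF assms(1)[OF that]])
  ultimately show ?thesis by (simp cong: measurable_cong)
qed

locale haar =
  fixes N :: nat and \<mu> :: "complex mat measure"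
  assumes haar: "haar_unitary N \<mu>"
begin

sublocale prob_space \<mu>
  using haar by (simp add: haar_unitary_def)

lemma sets_eq: "sets \<mu> = sets (unitary_borel N)"
  using haar by (simp add: haar_unitary_def)

lemma space_eq [simp]: "space \<mu> = unitary_group N"
  using sets_eq_imp_space_eq[OF sets_eq] by (simp add: unitary_borel_def)

lemma entry_measurable [measurable]:
  assumes "i < N" "j < N"
  shows "(\<lambda>U. U $$ (i, j)) \<in> borel_measurable \<mu>"
proof -
  have "(\<lambda>U. \<lambda>ij\<in>{..<N} \<times> {..<N}. U $$ ij) \<in> measurable (unitary_borel N) (PiM ({..<N} \<times> {..<N}) (\<lambda>_. borel))"
    unfolding unitary_borel_def by (rule measurable_vimage_algebra1) (auto simp: space_PiM)
  then have "(\<lambda>U. (\<lambda>ij\<in>{..<N} \<times> {..<N}. U $$ ij) (i, j)) \<in> borel_measurable (unitary_borel N)"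
    by (rule measurable_compose[OF _ measurable_component_singleton]) (use assms in auto)
  with assms show ?thesis by (simp add: measurable_cong_sets[OF sets_eq refl])
qed

lemma mult_measurable:
  assumes "V \<in> unitary_group N"
  shows "(\<lambda>U. V * U) \<in> measurable \<mu> \<mu>"
proof -
  note V = unitary_group_carrier[OF assms]
  have "(\<lambda>U. V * U) \<in> measurable \<mu> (unitary_borel N)"
    unfolding unitary_borel_def
  proof (rule measurable_vimage_algebra2)
    show "(\<lambda>U. V * U) \<in> space \<mu> \<rightarrow> unitary_group N"
      using unitary_group_mult[OF assms] by simp
    show "(\<lambda>U. \<lambda>ij\<in>{..<N} \<times> {..<N}. (V * U) $$ ij) \<in> measurable \<mu> (PiM ({..<N} \<times> {..<N}) (\<lambda>_. borel))"
    proof (rule measurable_restrict)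
      fix ij assume "ij \<in> {..<N} \<times> {..<N}"
      then obtain i j where ij: "ij = (i, j)" "i < N" "j < N" by auto
      have "(\<lambda>U. \<Sum>k<N. V $$ (i, k) * U $$ (k, j)) \<in> borel_measurable \<mu>"
        using ij by (intro borel_measurable_sum borel_measurable_times borel_measurable_const entry_measurable) auto
      moreover have "(V * U) $$ ij = (\<Sum>k<N. V $$ (i, k) * U $$ (k, j))" if "U \<in> space \<mu>" for U
        using mult_index_sum[OF V unitary_group_carrier ij(2,3)] that ij(1) by simp
      ultimately show "(\<lambda>U. (V * U) $$ ij) \<in> borel_measurable \<mu>"
        using measurable_cong[of \<mu> "\<lambda>U. (V * U) $$ ij" "\<lambda>U. \<Sum>k<N. V $$ (i, k) * U $$ (k, j)" borel] by blast
    qed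
  qed
  then show ?thesis by (simp add: measurable_cong_sets[OF refl sets_eq])
qed

text \<open>The definition of Haar measure speaks of images of sets, the distribution of preimages.
  The preimage of \<open>A\<close> under multiplication by \<open>V\<close> is its image under
  multiplication by the adjoint, to which invariance applies.\<close>

lemma distr_mult:
  assumes V: "V \<in> unitary_group N"
  shows "distr \<mu> \<mu> (\<lambda>U. V * U) = \<mu>"
proof (rule measure_eqI)
  fix A assume "A \<in> sets (distr \<mu> \<mu> (\<lambda>U. V * U))"
  then have A: "A \<in> sets \<mu>" by simp
  then have sub: "A \<subseteq> unitary_group N" using sets.sets_into_space by fastforce
  note C = unitary_group_carrier[OF V]
  note W = unitary_group_adjoint[OF V]
  note D = unitary_group_carrier[OF W]
  have inv: "V * (mat_adjoint V * U) = U" "mat_adjoint V * (V * U) = U" if "U \<in> unitary_group N" for U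
  proof -
    note U = unitary_group_carrier[OF that]
    show "V * (mat_adjoint V * U) = U"
      using assoc_mult_mat[OF C D U, symmetric] V left_mult_one_mat[OF U] by (simp add: unitary_group_def)
    show "mat_adjoint V * (V * U) = U"
      using assoc_mult_mat[OF D C U, symmetric] V left_mult_one_mat[OF U] by (simp add: unitary_group_def)
  qed
  have "(\<lambda>U. V * U) -` A \<inter> space \<mu> = (\<lambda>U. mat_adjoint V * U) ` A"
  proof (intro equalityI subsetI)
    fix U assume "U \<in> (\<lambda>U. V * U) -` A \<inter> space \<mu>"
    then show "U \<in> (\<lambda>U. mat_adjoint V * U) ` A" using inv(2)[of U] by (auto intro!: image_eqI[of _ _ "V * U"])
  next
    fix U assume "U \<in> (\<lambda>U. mat_adjoint V * U) ` A"
    then show "U \<in> (\<lambda>U. V * U) -` A \<inter> space \<mu>" using inv(1) sub unitary_group_mult[OF W] by auto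
  qed
  moreover have "emeasure \<mu> ((\<lambda>U. mat_adjoint V * U) ` A) = emeasure \<mu> A"
    using haar W A by (simp add: haar_unitary_def)
  ultimately show "emeasure (distr \<mu> \<mu> (\<lambda>U. V * U)) A = emeasure \<mu> A"
    by (simp add: emeasure_distr[OF mult_measurable[OF V] A])
qed simp

lemma nn_integral_mult:
  assumes "V \<in> unitary_group N" "f \<in> borel_measurable \<mu>"
  shows "(\<integral>\<^sup>+U. f (V * U) \<partial>\<mu>) = (\<integral>\<^sup>+U. f U \<partial>\<mu>)"
  using nn_integral_distr[OF mult_measurable[OF assms(1)], of f] assms(2) distr_mult[OF assms(1)] by simp

lemma integral_mult:
  fixes f :: "complex mat \<Rightarrow> real"
  assumes "V \<in> unitary_group N" "f \<in> borel_measurable \<mu>"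
  shows "(\<integral>U. f (V * U) \<partial>\<mu>) = (\<integral>U. f U \<partial>\<mu>)"
  using integral_distr[OF mult_measurable[OF assms(1)] assms(2)] distr_mult[OF assms(1)] by simp

section \<open>Moments of one entry\<close>

lemma integrable_entry_moment:
  assumes "0 < N" "i < N"
  shows "integrable \<mu> (\<lambda>U. cmod (U $$ (0, 0)) ^ m * cmod (U $$ (i, 0)) ^ l)"
proof (rule integrable_const_bound[where B = 1])
  show "AE U in \<mu>. norm (cmod (U $$ (0, 0)) ^ m * cmod (U $$ (i, 0)) ^ l) \<le> 1"
    using unitary_group_entry_le[of _ N] assms by (auto intro!: AE_I2 mult_le_one power_le_one)
  note [measurable] = entry_measurable[OF assms(1,1)] entry_measurable[OF assms(2,1)]
  show "(\<lambda>U. cmod (U $$ (0, 0)) ^ m * cmod (U $$ (i, 0)) ^ l) \<in> borel_measurable \<mu>"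
    by measurable
qed

text \<open>Multiplying by \<open>givens\<close> replaces \<open>U $$ (0, 0)\<close> by a
  combination of two entries of the first column without changing its law. Averaging over the phases
  \<open>w l\<close> of the second coefficient removes all cross terms of the binomial expansion, by
  Parseval.\<close>

lemma entry_moment_rotate:
  assumes i: "0 < i" "i < N" and xy: "x\<^sup>2 + y\<^sup>2 = 1"
  shows "(\<integral>U. cmod (U $$ (0, 0)) ^ (2 * M) \<partial>\<mu>) = (\<Sum>j\<le>M. (real (M choose j))\<^sup>2 * x ^ (2 * (M - j)) * y ^ (2 * j) *
    (\<integral>U. cmod (U $$ (0, 0)) ^ (2 * (M - j)) * cmod (U $$ (i, 0)) ^ (2 * j) \<partial>\<mu>))"
proof -
  have N: "0 < N" using i by simp
  \<comment> \<open>A binomial expansion of degree \<open>M\<close> has \<open>M + 1\<close>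
    coefficients, exactly as many as Parseval's identity with \<open>D\<close> points
    admits.\<close>
  define D where "D = Suc M"
  define w where "w l = cis (2 * pi * real l / real D)" for l
  note [measurable] = entry_measurable[OF N N] entry_measurable[OF i(2) N]
  have meas: "(\<lambda>U. cmod (U $$ (0, 0)) ^ (2 * M)) \<in> borel_measurable \<mu>" by measurable
  have rot: "(\<integral>U. cmod (of_real x * U $$ (0, 0) + of_real y * w l * U $$ (i, 0)) ^ (2 * M) \<partial>\<mu>) =
      (\<integral>U. cmod (U $$ (0, 0)) ^ (2 * M) \<partial>\<mu>)" for l
  proof -
    have V: "givens N i x (of_real y * w l) \<in> unitary_group N"
      using xy by (intro givens_unitary i) (simp add: w_def norm_mult)
    have "(\<integral>U. cmod (U $$ (0, 0)) ^ (2 * M) \<partial>\<mu>) =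
        (\<integral>U. cmod ((givens N i x (of_real y * w l) * U) $$ (0, 0)) ^ (2 * M) \<partial>\<mu>)"
      using integral_mult[OF V meas] by simp
    also have "\<dots> = (\<integral>U. cmod (of_real x * U $$ (0, 0) + of_real y * w l * U $$ (i, 0)) ^ (2 * M) \<partial>\<mu>)"
      by (intro Bochner_Integration.integral_cong refl) (simp add: givens_mult_00[OF i unitary_group_carrier])
    finally show ?thesis by simp
  qed
  have pt: "(\<Sum>l<D. cmod (of_real x * u + of_real y * w l * v) ^ (2 * M)) =
      real D * (\<Sum>j\<le>M. (real (M choose j))\<^sup>2 * x ^ (2 * (M - j)) * y ^ (2 * j) * (cmod u ^ (2 * (M - j)) * cmod v ^ (2 * j)))"
    for u v :: complex
  proof -
    define c where "c j = of_nat (M choose j) * (of_real y * v) ^ j * (of_real x * u) ^ (M - j)" for j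
    have "cmod (of_real x * u + of_real y * w l * v) ^ (2 * M) = (cmod (\<Sum>m<D. c m * w l ^ m))\<^sup>2" for l
    proof -
      have "(of_real x * u + of_real y * w l * v) ^ M = (of_real y * w l * v + of_real x * u) ^ M"
        by (simp add: add.commute)
      also have "\<dots> = (\<Sum>m<D. c m * w l ^ m)"
        unfolding binomial_ring D_def lessThan_Suc_atMost c_def
        by (intro sum.cong refl) (simp add: power_mult_distrib mult_ac)
      finally show ?thesis by (metis norm_power power_even_eq)
    qed
    then have "(\<Sum>l<D. cmod (of_real x * u + of_real y * w l * v) ^ (2 * M)) = real D * (\<Sum>m<D. (cmod (c m))\<^sup>2)"
      using sum_root_of_unity_norm_square[of D c] by (simp add: D_def w_def)
    also have "(\<Sum>m<D. (cmod (c m))\<^sup>2) = (\<Sum>j\<le>M. (real (M choose j))\<^sup>2 * x ^ (2 * (M - j)) * y ^ (2 * j) *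
        (cmod u ^ (2 * (M - j)) * cmod v ^ (2 * j)))"
      unfolding D_def lessThan_Suc_atMost c_def
      by (intro sum.cong refl) (simp add: norm_mult norm_power power_mult_distrib power_even_abs power_mult mult_ac
        flip: power_mult)
    finally show ?thesis .
  qed
  have int: "integrable \<mu> (\<lambda>U. cmod (of_real x * U $$ (0, 0) + of_real y * w l * U $$ (i, 0)) ^ (2 * M))" for l
  proof (rule integrable_const_bound[where B = "(\<bar>x\<bar> + \<bar>y\<bar>) ^ (2 * M)"])
    show "AE U in \<mu>. norm (cmod (of_real x * U $$ (0, 0) + of_real y * w l * U $$ (i, 0)) ^ (2 * M)) \<le> (\<bar>x\<bar> + \<bar>y\<bar>) ^ (2 * M)"
    proof (rule AE_I2)
      fix U assume "U \<in> space \<mu>"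
      then have U: "cmod (U $$ (0, 0)) \<le> 1" "cmod (U $$ (i, 0)) \<le> 1"
        using unitary_group_entry_le[of U N] N i by auto
      have "cmod (of_real x * U $$ (0, 0) + of_real y * w l * U $$ (i, 0)) \<le> \<bar>x\<bar> * cmod (U $$ (0, 0)) + \<bar>y\<bar> * cmod (U $$ (i, 0))"
        by (rule norm_triangle_le) (simp add: norm_mult w_def)
      also have "\<dots> \<le> \<bar>x\<bar> * 1 + \<bar>y\<bar> * 1"
        using U by (intro add_mono mult_left_mono) auto
      finally show "norm (cmod (of_real x * U $$ (0, 0) + of_real y * w l * U $$ (i, 0)) ^ (2 * M)) \<le> (\<bar>x\<bar> + \<bar>y\<bar>) ^ (2 * M)"
        by (simp add: power_mono)
    qed
  qed measurable
  have "real D * (\<integral>U. cmod (U $$ (0, 0)) ^ (2 * M) \<partial>\<mu>) =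
      (\<Sum>l<D. \<integral>U. cmod (of_real x * U $$ (0, 0) + of_real y * w l * U $$ (i, 0)) ^ (2 * M) \<partial>\<mu>)"
    by (simp add: rot)
  also have "\<dots> = (\<integral>U. (\<Sum>l<D. cmod (of_real x * U $$ (0, 0) + of_real y * w l * U $$ (i, 0)) ^ (2 * M)) \<partial>\<mu>)"
    by (intro Bochner_Integration.integral_sum[symmetric] int)
  also have "\<dots> = real D * (\<Sum>j\<le>M. (real (M choose j))\<^sup>2 * x ^ (2 * (M - j)) * y ^ (2 * j) *
    (\<integral>U. cmod (U $$ (0, 0)) ^ (2 * (M - j)) * cmod (U $$ (i, 0)) ^ (2 * j) \<partial>\<mu>))"
    unfolding pt using integrable_entry_moment[OF N i(2)]
    by (subst integral_mult_right_zero, subst Bochner_Integration.integral_sum) (auto simp: sum_distrib_left)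
  finally show ?thesis by (simp add: D_def)
qed

text \<open>The rotation identity holds for all angles; read as a polynomial identity in the squared
  tangent \<open>t\<close>, its linear coefficient is the claim.\<close>

lemma entry_moment_two:
  assumes i: "0 < i" "i < N"
  shows "real (Suc m) * (\<integral>U. cmod (U $$ (0, 0)) ^ (2 * m) * (cmod (U $$ (i, 0)))\<^sup>2 \<partial>\<mu>) =
    (\<integral>U. cmod (U $$ (0, 0)) ^ (2 * Suc m) \<partial>\<mu>)"
proof -
  define M where "M = Suc m"
  define a where "a = (\<integral>U. cmod (U $$ (0, 0)) ^ (2 * M) \<partial>\<mu>)"
  define e where "e j = (\<integral>U. cmod (U $$ (0, 0)) ^ (2 * (M - j)) * cmod (U $$ (i, 0)) ^ (2 * j) \<partial>\<mu>)" for j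
  have id: "(\<Sum>j\<le>M. (real (M choose j))\<^sup>2 * e j * t ^ j) = a * (1 + t) ^ M" if "t \<ge> 0" for t
  proof -
    \<comment> \<open>Cosine and sine of the angle whose squared tangent is \<open>t\<close>; every
      summand then carries the same factor \<open>(1 / (1 + t)) ^ M\<close>.\<close>
    define x where "x = 1 / sqrt (1 + t)"
    define y where "y = sqrt (t / (1 + t))"
    have x2: "x\<^sup>2 = 1 / (1 + t)" and y2: "y\<^sup>2 = t / (1 + t)"
      using that by (simp_all add: x_def y_def power_divide)
    have "x\<^sup>2 + y\<^sup>2 = 1" using that by (simp add: x2 y2 flip: add_divide_distrib)
    from entry_moment_rotate[OF i this, of M]
    have "a = (\<Sum>j\<le>M. (real (M choose j))\<^sup>2 * (1 / (1 + t)) ^ (M - j) * (t / (1 + t)) ^ j * e j)"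
      unfolding a_def e_def by (simp add: power_mult x2 y2)
    also have "\<dots> = (\<Sum>j\<le>M. (real (M choose j))\<^sup>2 * e j * t ^ j * (1 / (1 + t)) ^ M)"
    proof (intro sum.cong refl)
      fix j assume "j \<in> {..M}"
      then have "(1 / (1 + t)) ^ M = (1 / (1 + t)) ^ (M - j) * (1 / (1 + t)) ^ j" by (simp flip: power_add)
      then show "(real (M choose j))\<^sup>2 * (1 / (1 + t)) ^ (M - j) * (t / (1 + t)) ^ j * e j =
          (real (M choose j))\<^sup>2 * e j * t ^ j * (1 / (1 + t)) ^ M"
        by (simp add: power_divide mult_ac)
    qed
    finally show ?thesis using that by (simp add: power_divide flip: sum_distrib_right sum_divide_distrib)
  qed
  \<comment> \<open>The difference of the two sides of \<open>id\<close> as a polynomial; it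
    vanishes on a half-line, hence identically.\<close>
  define p where "p = (\<Sum>j\<le>M. monom ((real (M choose j))\<^sup>2 * e j - a * real (M choose j)) j)"
  have "poly p t = 0" if "t \<ge> 0" for t
  proof -
    have "(1 + t) ^ M = (\<Sum>j\<le>M. real (M choose j) * t ^ j)"
      using binomial_ring[of t 1 M] by (simp add: add.commute)
    with id[OF that] show ?thesis
      by (simp add: p_def poly_sum poly_monom left_diff_distrib right_diff_distrib sum_subtractf sum_distrib_left mult_ac)
  qed
  then have "{0..} \<subseteq> {t. poly p t = 0}" by auto
  moreover have "infinite {0 :: real..}" by (rule infinite_Ici)
  ultimately have "p = 0" using poly_roots_finite[of p] finite_subset by blast
  moreover have "coeff p 1 = (real (M choose 1))\<^sup>2 * e 1 - a * real (M choose 1)"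
    by (simp add: p_def coeff_sum M_def sum.delta)
  ultimately have "(real M)\<^sup>2 * e 1 = a * real M" by simp
  then have "real M * e 1 = a" by (simp add: M_def power2_eq_square)
  then show ?thesis by (simp add: e_def a_def M_def)
qed

text \<open>Inserting the squared norm of the first column, which is \<open>1\<close>, writes the
  moment as a sum over rows: row \<open>0\<close> gives the next moment, and each of the other
  \<open>N - 1\<close> rows gives \<open>1 / (m + 1)\<close> of it. The inverse binomial
  coefficients satisfy the same recursion.\<close>

lemma entry_moment:
  assumes "0 < N"
  shows "(\<integral>U. cmod (U $$ (0, 0)) ^ (2 * m) \<partial>\<mu>) = 1 / real ((N - 1 + m) choose m)"
proof (induction m)
  case 0
  then show ?case using prob_space by simp
next
  case (Suc m)
  obtain n where n: "N = Suc n" using assms gr0_conv_Suc by blast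
  define a where "a m = (\<integral>U. cmod (U $$ (0, 0)) ^ (2 * m) \<partial>\<mu>)" for m
  have int: "integrable \<mu> (\<lambda>U. cmod (U $$ (0, 0)) ^ (2 * m) * (cmod (U $$ (i, 0)))\<^sup>2)" if "i < N" for i
    by (rule integrable_entry_moment[OF assms that])
  have "a m = (\<integral>U. (\<Sum>i<N. cmod (U $$ (0, 0)) ^ (2 * m) * (cmod (U $$ (i, 0)))\<^sup>2) \<partial>\<mu>)"
    unfolding a_def sum_distrib_left[symmetric]
    by (intro Bochner_Integration.integral_cong refl) (simp add: unitary_group_col_norm[OF _ assms])
  also have "\<dots> = (\<Sum>i<N. \<integral>U. cmod (U $$ (0, 0)) ^ (2 * m) * (cmod (U $$ (i, 0)))\<^sup>2 \<partial>\<mu>)"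
    by (intro Bochner_Integration.integral_sum int) auto
  also have "\<dots> = a (Suc m) + (\<Sum>i<n. a (Suc m) / real (Suc m))"
  proof -
    have "(\<integral>U. cmod (U $$ (0, 0)) ^ (2 * m) * (cmod (U $$ (Suc i, 0)))\<^sup>2 \<partial>\<mu>) = a (Suc m) / real (Suc m)"
      if "i < n" for i
      using entry_moment_two[of "Suc i" m] that by (simp add: n a_def field_simps)
    then show ?thesis
      unfolding n sum.lessThan_Suc_shift by (simp add: a_def power2_eq_square mult_ac)
  qed
  also have "\<dots> = a (Suc m) * (real (Suc m + n) / real (Suc m))"
    by (simp add: field_simps)
  finally have rec: "a (Suc m) = a m * (real (Suc m) / real (Suc m + n))"
    by (simp add: field_simps)
  have "Suc m * ((n + Suc m) choose Suc m) = (Suc m + n) * ((n + m) choose m)"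
    using Suc_times_binomial_eq[of "n + m" m] by (simp add: mult_ac add_ac)
  then have "real (Suc m) * real ((n + Suc m) choose Suc m) = real (Suc m + n) * real ((n + m) choose m)"
    by (metis of_nat_mult)
  moreover have "real ((n + m) choose m) > 0" "real ((n + Suc m) choose Suc m) > 0"
    by (simp_all only: of_nat_0_less_iff zero_less_binomial le_add2)
  moreover have "a m = 1 / real ((n + m) choose m)" using Suc by (simp add: a_def n)
  ultimately have "a (Suc m) = 1 / real ((n + Suc m) choose Suc m)"
    unfolding rec by (simp add: frac_eq_eq mult_ac del: binomial_Suc_Suc add_Suc_right)
  then show ?case unfolding a_def n by (simp del: binomial_Suc_Suc add_Suc_right)
qed

end

section \<open>The exact moments of the determinant\<close>

lemma cis_smult_mult:
  "U \<in> carrier_mat N N \<Longrightarrow> cis t \<cdot>\<^sub>m 1\<^sub>m N * U = cis t \<cdot>\<^sub>m U"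
  by (simp add: mult_smult_assoc_mat[of _ N N _ N])

lemma cmod_det_minus_commute:
  fixes A B :: "complex mat"
  assumes "A \<in> carrier_mat N N" "B \<in> carrier_mat N N"
  shows "cmod (Determinant.det (A - B)) = cmod (Determinant.det (B - A))"
proof -
  have "A - B = (- 1) \<cdot>\<^sub>m (B - A)" using assms by (intro eq_matI) auto
  then show ?thesis by (simp add: norm_mult norm_power)
qed

text \<open>With \<open>n = N - 1\<close> the left side will be the moment of
  \<open>1 - U $$ (0, 0)\<close>. Cancelling factorials turns each summand into
  \<open>(k choose m) * ((n + k) choose (k - m))\<close> over the fixed denominator
  \<open>(n + k) choose k\<close>, and Vandermonde's convolution applies.\<close>

lemma sum_binomial_square_quotient:
  "(\<Sum>m\<le>k. (real (k choose m))\<^sup>2 / real ((n + m) choose m)) =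
    real ((n + 2 * k) choose k) / real ((n + k) choose k)"
proof -
  have "(real (k choose m))\<^sup>2 / real ((n + m) choose m) =
      real (k choose m) * real ((n + k) choose (k - m)) / real ((n + k) choose k)" if "m \<le> k" for m
  proof -
    have "n + k - (k - m) = n + m" using that by simp
    then show ?thesis
      using that by (simp add: binomial_fact power2_eq_square field_simps)
  qed
  then have "(\<Sum>m\<le>k. (real (k choose m))\<^sup>2 / real ((n + m) choose m)) =
      real (\<Sum>m\<le>k. (k choose m) * ((n + k) choose (k - m))) / real ((n + k) choose k)"
    by (simp add: sum_divide_distrib)
  also have "(\<Sum>m\<le>k. (k choose m) * ((n + k) choose (k - m))) = (n + 2 * k) choose k"
    using vandermonde[of k "n + k" k] by (simp add: mult_2 add_ac)
  finally show ?thesis .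
qed

lemma binomial_quotient_prod:
  "real ((n + 2 * k) choose k) / real ((n + k) choose k) = (\<Prod>i<k. real (n + k + i + 1) / real (n + i + 1))"
proof -
  have P: "fact (n + k) = fact n * (\<Prod>i<k. real (n + i + 1))" for n
    by (induction k) (simp_all add: algebra_simps)
  have *: "real ((n + k) choose k) = (\<Prod>i<k. real (n + i + 1)) / fact k" for n
    by (simp add: binomial_fact P)
  have "n + 2 * k = (n + k) + k" by simp
  then show ?thesis
    by (simp only: * prod_dividef) simp
qed

text \<open>The Keating-Snaith moment of order \<open>2 * k\<close> of the characteristic
  polynomial, for integral \<open>k\<close>; it is also MacMahon's count of plane partitions in a
  \<open>k\<close> by \<open>k\<close> by \<open>N\<close> box. In this form the number of factors
  does not grow with \<open>N\<close>, which suits the estimates for large \<open>N\<close>.\<close>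

definition det_moment :: "nat \<Rightarrow> nat \<Rightarrow> real" where
  "det_moment N k = (\<Prod>i<k. \<Prod>l<k. real (N + i + l + 1) / real (i + l + 1))"

lemma det_moment_nonneg: "det_moment N k \<ge> 0"
  unfolding det_moment_def by (intro prod_nonneg ballI) auto

text \<open>Raising the size by one shifts the numerators by one, so for each \<open>i\<close> the
  product over \<open>l\<close> of the quotients telescopes.\<close>

lemma det_moment_Suc:
  "det_moment (Suc n) k = (\<Prod>i<k. real (n + k + i + 1) / real (n + i + 1)) * det_moment n k"
proof -
  have tele: "(\<Prod>l<k. real (Suc n + i + l + 1) / real (n + i + l + 1)) = real (n + k + i + 1) / real (n + i + 1)" for i
    using prod_lessThan_telescope[of k "\<lambda>l. real (n + i + l + 1)"] by (simp add: add_ac)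
  have "det_moment (Suc n) k =
      (\<Prod>i<k. \<Prod>l<k. (real (Suc n + i + l + 1) / real (n + i + l + 1)) * (real (n + i + l + 1) / real (i + l + 1)))"
    unfolding det_moment_def by (intro prod.cong refl) simp
  then show ?thesis
    unfolding prod.distrib tele det_moment_def .
qed

context haar
begin

lemma integrable_one_minus_entry:
  assumes N: "0 < N" and z: "cmod z = 1"
  shows "integrable \<mu> (\<lambda>U. cmod (1 - z * U $$ (0, 0)) ^ k)"
proof (rule integrable_const_bound[where B = "2 ^ k"])
  show "AE U in \<mu>. norm (cmod (1 - z * U $$ (0, 0)) ^ k) \<le> 2 ^ k"
  proof (rule AE_I2)
    fix U assume "U \<in> space \<mu>"
    then have "cmod (U $$ (0, 0)) \<le> 1"
      using unitary_group_entry_le[of U N] N by auto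
    then have "cmod (1 - z * U $$ (0, 0)) \<le> 2"
      using norm_triangle_ineq4[of 1 "z * U $$ (0, 0)"] z by (simp add: norm_mult)
    then show "norm (cmod (1 - z * U $$ (0, 0)) ^ k) \<le> 2 ^ k"
      by (simp add: power_mono)
  qed
  note [measurable] = entry_measurable[OF N N]
  show "(\<lambda>U. cmod (1 - z * U $$ (0, 0)) ^ k) \<in> borel_measurable \<mu>" by measurable
qed

text \<open>Multiplying \<open>U\<close> by a scalar phase preserves its law, and averaging over
  \<open>k + 1\<close> phases keeps only the diagonal terms of the binomial expansion. The entry
  moments and Vandermonde's convolution then give the product.\<close>

lemma integral_one_minus_entry:
  assumes N: "0 < N"
  shows "(\<integral>U. cmod (1 - U $$ (0, 0)) ^ (2 * k) \<partial>\<mu>) =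
    (\<Prod>i<k. real (N - 1 + k + i + 1) / real (N - 1 + i + 1))"
proof -
  define D where "D = Suc k"
  define w where "w l = cis (2 * pi * real l / real D)" for l
  note [measurable] = entry_measurable[OF N N]
  have meas: "(\<lambda>U. cmod (1 - U $$ (0, 0)) ^ (2 * k)) \<in> borel_measurable \<mu>" by measurable
  have rot: "(\<integral>U. cmod (1 - w l * U $$ (0, 0)) ^ (2 * k) \<partial>\<mu>) =
      (\<integral>U. cmod (1 - U $$ (0, 0)) ^ (2 * k) \<partial>\<mu>)" for l
  proof -
    have "(\<integral>U. cmod (1 - U $$ (0, 0)) ^ (2 * k) \<partial>\<mu>) =
        (\<integral>U. cmod (1 - (w l \<cdot>\<^sub>m 1\<^sub>m N * U) $$ (0, 0)) ^ (2 * k) \<partial>\<mu>)"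
      unfolding w_def using integral_mult[OF cis_unitary_group meas] by simp
    also have "\<dots> = (\<integral>U. cmod (1 - w l * U $$ (0, 0)) ^ (2 * k) \<partial>\<mu>)"
    proof (intro Bochner_Integration.integral_cong refl)
      fix U assume "U \<in> space \<mu>"
      then have U: "U \<in> carrier_mat N N" by (simp add: unitary_group_carrier)
      show "cmod (1 - (w l \<cdot>\<^sub>m 1\<^sub>m N * U) $$ (0, 0)) ^ (2 * k) = cmod (1 - w l * U $$ (0, 0)) ^ (2 * k)"
        unfolding w_def cis_smult_mult[OF U] using U N by simp
    qed
    finally show ?thesis by simp
  qed
  have pt: "(\<Sum>l<D. cmod (1 - w l * u) ^ (2 * k)) = real D * (\<Sum>j\<le>k. (real (k choose j))\<^sup>2 * cmod u ^ (2 * j))"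
    for u :: complex
  proof -
    define c where "c j = of_nat (k choose j) * (- u) ^ j" for j
    have "cmod (1 - w l * u) ^ (2 * k) = (cmod (\<Sum>m<D. c m * w l ^ m))\<^sup>2" for l
    proof -
      have "(1 - w l * u) ^ k = (w l * (- u) + 1) ^ k" by simp
      also have "\<dots> = (\<Sum>m<D. c m * w l ^ m)"
        unfolding binomial_ring D_def lessThan_Suc_atMost c_def
        by (intro sum.cong refl) (simp only: power_mult_distrib mult_ac power_one mult_1_right mult_1_left)
      finally show ?thesis by (metis norm_power power_even_eq)
    qed
    then have "(\<Sum>l<D. cmod (1 - w l * u) ^ (2 * k)) = real D * (\<Sum>m<D. (cmod (c m))\<^sup>2)"
      using sum_root_of_unity_norm_square[of D c] by (simp add: D_def w_def)
    also have "(\<Sum>m<D. (cmod (c m))\<^sup>2) = (\<Sum>j\<le>k. (real (k choose j))\<^sup>2 * cmod u ^ (2 * j))"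
      unfolding D_def lessThan_Suc_atMost c_def
      by (intro sum.cong refl) (simp add: norm_mult norm_power power_mult_distrib mult_ac flip: power_mult)
    finally show ?thesis .
  qed
  have int: "integrable \<mu> (\<lambda>U. cmod (1 - w l * U $$ (0, 0)) ^ (2 * k))" for l
    by (rule integrable_one_minus_entry[OF N]) (simp add: w_def)
  have inte: "integrable \<mu> (\<lambda>U. cmod (U $$ (0, 0)) ^ (2 * m))" for m
    using integrable_entry_moment[OF N N, of "2 * m" 0] by simp
  have "real D * (\<integral>U. cmod (1 - U $$ (0, 0)) ^ (2 * k) \<partial>\<mu>) =
      (\<Sum>l<D. \<integral>U. cmod (1 - w l * U $$ (0, 0)) ^ (2 * k) \<partial>\<mu>)"
    by (simp add: rot)
  also have "\<dots> = (\<integral>U. (\<Sum>l<D. cmod (1 - w l * U $$ (0, 0)) ^ (2 * k)) \<partial>\<mu>)"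
    by (intro Bochner_Integration.integral_sum[symmetric] int)
  also have "\<dots> = real D * (\<Sum>j\<le>k. (real (k choose j))\<^sup>2 * (\<integral>U. cmod (U $$ (0, 0)) ^ (2 * j) \<partial>\<mu>))"
    unfolding pt using inte
    by (subst integral_mult_right_zero, subst Bochner_Integration.integral_sum) (auto simp: sum_distrib_left)
  finally show ?thesis
    unfolding entry_moment[OF N] binomial_quotient_prod[symmetric] sum_binomial_square_quotient[symmetric]
    by (simp add: D_def)
qed

lemma measurable_det_diff:
  assumes "W \<in> unitary_group N"
  shows "(\<lambda>U. ennreal (cmod (Determinant.det (W - U)) ^ k)) \<in> borel_measurable \<mu>"
proof -
  note W = unitary_group_carrier[OF assms]
  have "(\<lambda>U. Determinant.det (W - U)) \<in> borel_measurable \<mu>"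
  proof (rule borel_measurable_det[where n = N])
    fix i j assume ij: "i < N" "j < N"
    have "(\<lambda>U. W $$ (i, j) - U $$ (i, j)) \<in> borel_measurable \<mu>"
      by (intro borel_measurable_diff borel_measurable_const entry_measurable ij)
    moreover have "(W - U) $$ (i, j) = W $$ (i, j) - U $$ (i, j)" if "U \<in> space \<mu>" for U
      using unitary_group_carrier[of U N] that ij by auto
    ultimately show "(\<lambda>U. (W - U) $$ (i, j)) \<in> borel_measurable \<mu>"
      using measurable_cong[of \<mu> "\<lambda>U. (W - U) $$ (i, j)" "\<lambda>U. W $$ (i, j) - U $$ (i, j)" borel] by blast
  qed (use unitary_group_carrier in \<open>auto intro!: minus_carrier_mat\<close>)
  then show ?thesis by measurable
qed

text \<open>Replace \<open>U\<close> by \<open>mat_adjoint W * U\<close> and pull out the adjoint,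
  whose determinant has modulus one. Nonnegative integrals keep the later exchange of integrations
  free of integrability conditions.\<close>

lemma nn_integral_det_diff:
  assumes W: "W \<in> unitary_group N"
  shows "(\<integral>\<^sup>+U. ennreal (cmod (Determinant.det (W - U)) ^ k) \<partial>\<mu>) =
    (\<integral>\<^sup>+U. ennreal (cmod (Determinant.det (1\<^sub>m N - U)) ^ k) \<partial>\<mu>)"
proof -
  note A = unitary_group_adjoint[OF W]
  note C = unitary_group_carrier[OF W] unitary_group_carrier[OF A]
  have "(\<integral>\<^sup>+U. ennreal (cmod (Determinant.det (1\<^sub>m N - U)) ^ k) \<partial>\<mu>) =
      (\<integral>\<^sup>+U. ennreal (cmod (Determinant.det (1\<^sub>m N - mat_adjoint W * U)) ^ k) \<partial>\<mu>)"
    by (rule nn_integral_mult[OF A measurable_det_diff[OF one_unitary_group], symmetric])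
  also have "\<dots> = (\<integral>\<^sup>+U. ennreal (cmod (Determinant.det (W - U)) ^ k) \<partial>\<mu>)"
  proof (intro nn_integral_cong)
    fix U assume "U \<in> space \<mu>"
    then have U: "U \<in> carrier_mat N N" by (simp add: unitary_group_carrier)
    have "1\<^sub>m N - mat_adjoint W * U = mat_adjoint W * (W - U)"
      using mult_minus_distrib_mat[OF C(2,1) U] W by (simp add: unitary_group_def)
    then have "cmod (Determinant.det (1\<^sub>m N - mat_adjoint W * U)) = cmod (Determinant.det (W - U))"
      using det_mult[OF C(2) minus_carrier_mat[OF U, of W]] cmod_det_unitary[OF A] by (simp add: norm_mult)
    then show "ennreal (cmod (Determinant.det (1\<^sub>m N - mat_adjoint W * U)) ^ k) =
        ennreal (cmod (Determinant.det (W - U)) ^ k)" by simp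
  qed
  finally show ?thesis ..
qed

end

text \<open>The double integral of \<open>f\<close> is computed in both orders. Integrating over
  \<open>U\<close> first removes \<open>V\<close> by invariance; integrating over \<open>V\<close>
  first splits off the factor in \<open>U $$ (0, 0)\<close> and removes \<open>U'\<close> by
  invariance in the smaller group.\<close>

lemma nn_integral_det_Suc:
  assumes "haar n \<mu>'" "haar (Suc n) \<mu>"
  shows "(\<integral>\<^sup>+U. ennreal (cmod (Determinant.det (1\<^sub>m (Suc n) - U)) ^ (2 * k)) \<partial>\<mu>) =
    ennreal (\<Prod>i<k. real (n + k + i + 1) / real (n + i + 1)) *
    (\<integral>\<^sup>+V. ennreal (cmod (Determinant.det (1\<^sub>m n - V)) ^ (2 * k)) \<partial>\<mu>')"
proof -
  interpret small: haar n \<mu>' by fact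
  interpret large: haar "Suc n" \<mu> by fact
  interpret pair_sigma_finite \<mu>' \<mu> ..
  define f where "f = (\<lambda>(V, U). ennreal (cmod (Determinant.det (corner_one n V - U)) ^ (2 * k)))"
  define F where "F = (\<integral>\<^sup>+V. ennreal (cmod (Determinant.det (1\<^sub>m n - V)) ^ (2 * k)) \<partial>\<mu>')"
  have car: "corner_one n V - U \<in> carrier_mat (Suc n) (Suc n)" if "V \<in> unitary_group n" "U \<in> unitary_group (Suc n)" for V U
    using unitary_group_carrier[OF that(2)] by (rule minus_carrier_mat)
  have "(\<lambda>(V, U). Determinant.det (corner_one n V - U)) \<in> borel_measurable (\<mu>' \<Otimes>\<^sub>M \<mu>)"
    unfolding split_beta'
  proof (rule borel_measurable_det[where n = "Suc n"])
    fix i j assume ij: "i < Suc n" "j < Suc n"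
    define g where "g = (\<lambda>V :: complex mat. if i = 0 \<or> j = 0 then (if i = j then 1 else 0) else V $$ (i - 1, j - 1))"
    have "g \<in> borel_measurable \<mu>'"
      unfolding g_def using ij by (cases "i = 0 \<or> j = 0") (auto intro: small.entry_measurable)
    then have "(\<lambda>x. g (fst x) - snd x $$ (i, j)) \<in> borel_measurable (\<mu>' \<Otimes>\<^sub>M \<mu>)"
      by (intro borel_measurable_diff measurable_compose[OF measurable_fst]
          measurable_compose[OF measurable_snd large.entry_measurable[OF ij]])
    moreover have "(corner_one n (fst x) - snd x) $$ (i, j) = g (fst x) - snd x $$ (i, j)"
      if "x \<in> space (\<mu>' \<Otimes>\<^sub>M \<mu>)" for x
    proof -
      have "fst x \<in> carrier_mat n n" "snd x \<in> carrier_mat (Suc n) (Suc n)"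
        using that unitary_group_carrier by (auto simp: space_pair_measure)
      then show ?thesis using ij corner_one_index[of "fst x" n i j] by (simp add: g_def)
    qed
    ultimately show "(\<lambda>x. (corner_one n (fst x) - snd x) $$ (i, j)) \<in> borel_measurable (\<mu>' \<Otimes>\<^sub>M \<mu>)"
      using measurable_cong[of "\<mu>' \<Otimes>\<^sub>M \<mu>" "\<lambda>x. (corner_one n (fst x) - snd x) $$ (i, j)"
          "\<lambda>x. g (fst x) - snd x $$ (i, j)" borel] by blast
  qed (use car in \<open>auto simp: space_pair_measure\<close>)
  then have "f \<in> borel_measurable (\<mu>' \<Otimes>\<^sub>M \<mu>)"
    unfolding f_def split_beta' by measurable
  from Fubini[OF this]
  have fub: "(\<integral>\<^sup>+U. (\<integral>\<^sup>+V. f (V, U) \<partial>\<mu>') \<partial>\<mu>) = (\<integral>\<^sup>+V. (\<integral>\<^sup>+U. f (V, U) \<partial>\<mu>) \<partial>\<mu>')" .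
  have "(\<integral>\<^sup>+V. (\<integral>\<^sup>+U. f (V, U) \<partial>\<mu>) \<partial>\<mu>') =
      (\<integral>\<^sup>+V. (\<integral>\<^sup>+U. ennreal (cmod (Determinant.det (1\<^sub>m (Suc n) - U)) ^ (2 * k)) \<partial>\<mu>) \<partial>\<mu>')"
    unfolding f_def prod.case
    by (intro nn_integral_cong large.nn_integral_det_diff corner_one_unitary) simp
  also have "\<dots> = (\<integral>\<^sup>+U. ennreal (cmod (Determinant.det (1\<^sub>m (Suc n) - U)) ^ (2 * k)) \<partial>\<mu>)"
    using small.emeasure_space_1 by simp
  finally have L: "(\<integral>\<^sup>+V. (\<integral>\<^sup>+U. f (V, U) \<partial>\<mu>) \<partial>\<mu>') =
      (\<integral>\<^sup>+U. ennreal (cmod (Determinant.det (1\<^sub>m (Suc n) - U)) ^ (2 * k)) \<partial>\<mu>)" .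
  \<comment> \<open>\<open>U'\<close> is chosen separately for every \<open>U\<close>, and the
    remaining integral over \<open>V\<close> has the value \<open>F\<close> for each such
    choice.\<close>
  have inner: "(\<integral>\<^sup>+V. f (V, U) \<partial>\<mu>') = ennreal (cmod (1 - U $$ (0, 0)) ^ (2 * k)) * F" if "U \<in> space \<mu>" for U
  proof -
    have Uin: "U \<in> unitary_group (Suc n)" using that by simp
    obtain U' where U': "U' \<in> unitary_group n" "\<And>V. V \<in> unitary_group n \<Longrightarrow>
        Determinant.det (corner_one n V - U) = (1 - U $$ (0, 0)) * Determinant.det (V - U')"
      using corner_one_diff_obtain[OF Uin] by blast
    have "(\<integral>\<^sup>+V. f (V, U) \<partial>\<mu>') = (\<integral>\<^sup>+V. ennreal (cmod (1 - U $$ (0, 0)) ^ (2 * k)) *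
        ennreal (cmod (Determinant.det (U' - V)) ^ (2 * k)) \<partial>\<mu>')"
    proof (intro nn_integral_cong)
      fix V assume "V \<in> space \<mu>'"
      then have "V \<in> unitary_group n" by simp
      then show "f (V, U) = ennreal (cmod (1 - U $$ (0, 0)) ^ (2 * k)) * ennreal (cmod (Determinant.det (U' - V)) ^ (2 * k))"
        using cmod_det_minus_commute[of V n U'] unitary_group_carrier U'
        by (simp add: f_def norm_mult power_mult_distrib ennreal_mult)
    qed
    also have "\<dots> = ennreal (cmod (1 - U $$ (0, 0)) ^ (2 * k)) * F"
      unfolding F_def by (subst nn_integral_cmult)
        (simp_all add: small.measurable_det_diff[OF U'(1)] small.nn_integral_det_diff[OF U'(1)])
    finally show ?thesis .
  qed
  note [measurable] = large.entry_measurable[OF zero_less_Suc zero_less_Suc]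
  have int: "integrable \<mu> (\<lambda>U. cmod (1 - U $$ (0, 0)) ^ (2 * k))"
    using large.integrable_one_minus_entry[of 1 "2 * k"] by simp
  have "(\<integral>\<^sup>+U. (\<integral>\<^sup>+V. f (V, U) \<partial>\<mu>') \<partial>\<mu>) = (\<integral>\<^sup>+U. ennreal (cmod (1 - U $$ (0, 0)) ^ (2 * k)) * F \<partial>\<mu>)"
    by (rule nn_integral_cong[OF inner])
  also have "\<dots> = (\<integral>\<^sup>+U. ennreal (cmod (1 - U $$ (0, 0)) ^ (2 * k)) \<partial>\<mu>) * F"
    by (rule nn_integral_multc) measurable
  also have "(\<integral>\<^sup>+U. ennreal (cmod (1 - U $$ (0, 0)) ^ (2 * k)) \<partial>\<mu>) =
      ennreal (\<Prod>i<k. real (n + k + i + 1) / real (n + i + 1))"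
    using nn_integral_eq_integral[OF int] large.integral_one_minus_entry[of k] by simp
  finally show ?thesis unfolding L[symmetric] fub[symmetric] F_def .
qed

text \<open>Iterates the reduction down to size one, passing through a Haar measure of every size in
  between.\<close>

lemma nn_integral_det_moment:
  assumes "\<And>N. N \<ge> 1 \<Longrightarrow> haar N (\<mu> N)"
  shows "(\<integral>\<^sup>+U. ennreal (cmod (Determinant.det (1\<^sub>m (Suc n) - U)) ^ (2 * k)) \<partial>\<mu> (Suc n)) = ennreal (det_moment (Suc n) k)"
proof (induction n)
  case 0
  interpret haar "Suc 0" "\<mu> (Suc 0)" using assms by simp
  note [measurable] = entry_measurable[OF zero_less_Suc zero_less_Suc]
  have "(\<integral>\<^sup>+U. ennreal (cmod (Determinant.det (1\<^sub>m (Suc 0) - U)) ^ (2 * k)) \<partial>\<mu> (Suc 0)) =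
      (\<integral>\<^sup>+U. ennreal (cmod (1 - U $$ (0, 0)) ^ (2 * k)) \<partial>\<mu> (Suc 0))"
  proof (intro nn_integral_cong)
    fix U assume "U \<in> space (\<mu> (Suc 0))"
    then have U: "U \<in> carrier_mat 1 1" using unitary_group_carrier[of U 1] by simp
    then have "Determinant.det (1\<^sub>m (Suc 0) - U) = 1 - U $$ (0, 0)"
      by (subst det_single) auto
    then show "ennreal (cmod (Determinant.det (1\<^sub>m (Suc 0) - U)) ^ (2 * k)) = ennreal (cmod (1 - U $$ (0, 0)) ^ (2 * k))"
      by simp
  qed
  also have "\<dots> = ennreal (\<integral>U. cmod (1 - U $$ (0, 0)) ^ (2 * k) \<partial>\<mu> (Suc 0))"
    using integrable_one_minus_entry[of 1 "2 * k"] by (intro nn_integral_eq_integral) simp_all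
  also have "\<dots> = ennreal (det_moment (Suc 0) k)"
    \<comment> \<open>All factors of \<open>det_moment 0 k\<close> are \<open>1\<close>, so the
      recursion at size zero already gives the base case.\<close>
    unfolding det_moment_Suc integral_one_minus_entry[OF zero_less_Suc] by (simp add: det_moment_def)
  finally show ?case .
next
  case (Suc n)
  show ?case
    unfolding nn_integral_det_Suc[OF assms assms, of "Suc n", simplified] Suc.IH det_moment_Suc[of "Suc n"]
    by (subst ennreal_mult) (auto intro!: prod_nonneg det_moment_nonneg)
qed

section \<open>The maximum over the circle\<close>

lemma cmod_Lambda_eq_poly:
  assumes U: "U \<in> carrier_mat N N"
  shows "cmod (Lambda U \<theta>) = cmod (poly (char_poly U) (cis \<theta>))"
proof -
  have "1\<^sub>m N - cis (- \<theta>) \<cdot>\<^sub>m U = cis (- \<theta>) \<cdot>\<^sub>m (- char_matrix U (cis \<theta>))"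
    using U by (intro eq_matI) (auto simp: char_matrix_def algebra_simps cis_mult)
  then show ?thesis
    using U by (simp add: Lambda_def char_poly_matrix[OF U] norm_mult norm_power)
qed

text \<open>\<open>Q\<close> is the \<open>k\<close>-th power of the characteristic polynomial and
  has \<open>D\<close> coefficients. On the unit circle it is at most the sum of their moduli;
  Cauchy-Schwarz passes to the sum of squares at the cost of a factor \<open>D\<close>, which is
  precisely the factor in Parseval's identity.\<close>

lemma max_Lambda_power_le:
  assumes U: "U \<in> carrier_mat N N"
  shows "max_Lambda U ^ (2 * k) \<le>
    (\<Sum>j<k * N + 1. cmod (Lambda U (2 * pi * real j / real (k * N + 1))) ^ (2 * k))"
proof -
  define D where "D = k * N + 1"
  define Q where "Q = char_poly U ^ k"
  have "degree Q \<le> k * N"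
    using degree_power_le[of "char_poly U" k] degree_monic_char_poly[OF U] by (simp add: Q_def mult.commute)
  then have Q: "poly Q z = (\<Sum>m<D. coeff Q m * z ^ m)" for z
    unfolding poly_altdef by (intro sum.mono_neutral_left) (auto simp: D_def coeff_eq_0)
  have Lam: "cmod (Lambda U \<theta>) ^ (2 * k) = (cmod (\<Sum>m<D. coeff Q m * cis \<theta> ^ m))\<^sup>2" for \<theta>
  proof -
    have "cmod (Lambda U \<theta>) ^ (2 * k) = (cmod (poly Q (cis \<theta>)))\<^sup>2"
      by (simp add: cmod_Lambda_eq_poly[OF U] Q_def norm_power mult.commute flip: power_mult)
    then show ?thesis unfolding Q .
  qed
  obtain \<theta> where \<theta>: "max_Lambda U = cmod (Lambda U \<theta>)" by (rule max_Lambda_attained[OF U])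
  have "cmod (\<Sum>m<D. coeff Q m * cis \<theta> ^ m) \<le> (\<Sum>m<D. cmod (coeff Q m))"
    by (rule sum_norm_le) (simp add: norm_mult norm_power)
  then have "max_Lambda U ^ (2 * k) \<le> (\<Sum>m<D. cmod (coeff Q m))\<^sup>2"
    unfolding \<theta> Lam by (intro power_mono) auto
  also have "\<dots> \<le> real D * (\<Sum>m<D. (cmod (coeff Q m))\<^sup>2)"
    using sum_squared_le_sum_of_squares[of "\<lambda>m. cmod (coeff Q m)" "{..<D}"] by (simp add: mult.commute)
  also have "\<dots> = (\<Sum>j<D. cmod (Lambda U (2 * pi * real j / real D)) ^ (2 * k))"
    unfolding Lam by (rule sum_root_of_unity_norm_square[symmetric]) (simp add: D_def)
  finally show ?thesis unfolding D_def .
qed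

lemma max_Lambda_ge: "U \<in> carrier_mat N N \<Longrightarrow> cmod (Lambda U \<theta>) \<le> max_Lambda U"
  using max_Lambda_attained[of U N] by metis

text \<open>Describes the event by countably many conditions, for measurability. The maximum may be
  attained only at irrational angles, hence the slack \<open>1 / real (Suc n)\<close>.\<close>

lemma max_Lambda_ge_iff:
  assumes U: "U \<in> carrier_mat N N"
  shows "c \<le> max_Lambda U \<longleftrightarrow> (\<forall>n :: nat. \<exists>r :: rat. c - 1 / real (Suc n) < cmod (Lambda U (of_rat r)))"
proof
  assume c: "c \<le> max_Lambda U"
  show "\<forall>n :: nat. \<exists>r :: rat. c - 1 / real (Suc n) < cmod (Lambda U (of_rat r))"
  proof
    fix n :: nat
    obtain \<theta> where \<theta>: "max_Lambda U = cmod (Lambda U \<theta>)" by (rule max_Lambda_attained[OF U])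
    have "isCont (\<lambda>\<theta>. cmod (Lambda U \<theta>)) \<theta>"
      using continuous_on_Lambda[OF U, of UNIV] by (auto simp: continuous_on_eq_continuous_at intro: continuous_norm)
    then obtain d where d: "d > 0" "\<And>t. \<bar>t - \<theta>\<bar> < d \<Longrightarrow> \<bar>cmod (Lambda U t) - cmod (Lambda U \<theta>)\<bar> < 1 / real (Suc n)"
      unfolding continuous_at_eps_delta dist_real_def by (metis of_nat_0_less_iff zero_less_Suc zero_less_divide_1_iff)
    obtain r :: rat where "\<theta> < of_rat r" "of_rat r < \<theta> + d" using of_rat_dense[of \<theta> "\<theta> + d"] d by auto
    then have "\<bar>cmod (Lambda U (of_rat r)) - cmod (Lambda U \<theta>)\<bar> < 1 / real (Suc n)" by (intro d) auto
    with c \<theta> have "c - 1 / real (Suc n) < cmod (Lambda U (of_rat r))" by linarith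
    then show "\<exists>r :: rat. c - 1 / real (Suc n) < cmod (Lambda U (of_rat r))" ..
  qed
next
  assume *: "\<forall>n :: nat. \<exists>r :: rat. c - 1 / real (Suc n) < cmod (Lambda U (of_rat r))"
  show "c \<le> max_Lambda U"
  proof (rule ccontr)
    assume "\<not> c \<le> max_Lambda U"
    then obtain n where "inverse (real (Suc n)) < c - max_Lambda U"
      using reals_Archimedean[of "c - max_Lambda U"] by auto
    moreover obtain r :: rat where "c - 1 / real (Suc n) < cmod (Lambda U (of_rat r))" using * by blast
    ultimately show False using max_Lambda_ge[OF U, of "of_rat r"] by (simp add: inverse_eq_divide)
  qed
qed

section \<open>Probabilities for the maximum from moments\<close>

context haar
begin

lemma Lambda_measurable [measurable]: "(\<lambda>U. Lambda U \<theta>) \<in> borel_measurable \<mu>"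
  unfolding Lambda_def
proof (rule borel_measurable_det[where n = N])
  fix i j assume ij: "i < N" "j < N"
  have "(\<lambda>U. (if i = j then 1 else 0) - cis (- \<theta>) * U $$ (i, j)) \<in> borel_measurable \<mu>"
    by (intro borel_measurable_diff borel_measurable_times borel_measurable_const entry_measurable ij)
  moreover have "(1\<^sub>m (dim_row U) - cis (- \<theta>) \<cdot>\<^sub>m U) $$ (i, j) = (if i = j then 1 else 0) - cis (- \<theta>) * U $$ (i, j)"
    if "U \<in> space \<mu>" for U
    using unitary_group_carrier[of U N] that ij by auto
  ultimately show "(\<lambda>U. (1\<^sub>m (dim_row U) - cis (- \<theta>) \<cdot>\<^sub>m U) $$ (i, j)) \<in> borel_measurable \<mu>"
    using measurable_cong[of \<mu> "\<lambda>U. (1\<^sub>m (dim_row U) - cis (- \<theta>) \<cdot>\<^sub>m U) $$ (i, j)"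
        "\<lambda>U. (if i = j then 1 else 0) - cis (- \<theta>) * U $$ (i, j)" borel] by blast
qed (use unitary_group_carrier in \<open>auto intro!: minus_carrier_mat\<close>)

lemma sets_max_Lambda_ge: "{U \<in> space \<mu>. c \<le> max_Lambda U} \<in> sets \<mu>"
proof -
  have "{U \<in> space \<mu>. c \<le> max_Lambda U} =
      {U \<in> space \<mu>. \<forall>n :: nat. \<exists>r :: rat. c - 1 / real (Suc n) < cmod (Lambda U (of_rat r))}"
    using max_Lambda_ge_iff[OF unitary_group_carrier] by auto
  also have "\<dots> \<in> sets \<mu>" by measurable
  finally show ?thesis .
qed

text \<open>Invariance under the scalar matrix \<open>cis (- \<theta>)\<close> makes the moments the
  same at every angle.\<close>

lemma nn_integral_Lambda:
  "(\<integral>\<^sup>+U. ennreal (cmod (Lambda U \<theta>) ^ k) \<partial>\<mu>) =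
    (\<integral>\<^sup>+U. ennreal (cmod (Determinant.det (1\<^sub>m N - U)) ^ k) \<partial>\<mu>)"
proof -
  have "(\<integral>\<^sup>+U. ennreal (cmod (Lambda U \<theta>) ^ k) \<partial>\<mu>) =
      (\<integral>\<^sup>+U. ennreal (cmod (Determinant.det (1\<^sub>m N - cis (- \<theta>) \<cdot>\<^sub>m 1\<^sub>m N * U)) ^ k) \<partial>\<mu>)"
  proof (intro nn_integral_cong)
    fix U assume "U \<in> space \<mu>"
    then have "U \<in> carrier_mat N N" by (simp add: unitary_group_carrier)
    then show "ennreal (cmod (Lambda U \<theta>) ^ k) = ennreal (cmod (Determinant.det (1\<^sub>m N - cis (- \<theta>) \<cdot>\<^sub>m 1\<^sub>m N * U)) ^ k)"
      by (simp add: Lambda_def cis_smult_mult)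
  qed
  also have "\<dots> = (\<integral>\<^sup>+U. ennreal (cmod (Determinant.det (1\<^sub>m N - U)) ^ k) \<partial>\<mu>)"
    by (rule nn_integral_mult[OF cis_unitary_group measurable_det_diff[OF one_unitary_group]])
  finally show ?thesis .
qed

text \<open>Markov's inequality for the power \<open>2 * k\<close>, with the maximum replaced by the
  sum over \<open>D\<close> sample points, each of which contributes the same moment.\<close>

lemma prob_max_Lambda_le:
  assumes M: "\<And>\<theta>. (\<integral>\<^sup>+U. ennreal (cmod (Lambda U \<theta>) ^ (2 * k)) \<partial>\<mu>) = ennreal (det_moment N k)"
  shows "prob {U \<in> space \<mu>. exp x \<le> max_Lambda U} \<le> real (k * N + 1) * det_moment N k * exp (- 2 * real k * x)"
proof -
  define S where "S = {U \<in> space \<mu>. exp x \<le> max_Lambda U}"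
  define D where "D = k * N + 1"
  define t where "t j = 2 * pi * real j / real D" for j
  have S: "S \<in> sets \<mu>" unfolding S_def by (rule sets_max_Lambda_ge)
  have "ennreal (exp (2 * real k * x) * prob S) = (\<integral>\<^sup>+U. ennreal (exp (2 * real k * x)) * indicator S U \<partial>\<mu>)"
    using S by (simp add: nn_integral_cmult_indicator emeasure_eq_measure ennreal_mult)
  also have "\<dots> \<le> (\<integral>\<^sup>+U. (\<Sum>j<D. ennreal (cmod (Lambda U (t j)) ^ (2 * k))) \<partial>\<mu>)"
  proof (intro nn_integral_mono)
    fix U assume "U \<in> space \<mu>"
    then have U: "U \<in> carrier_mat N N" by (simp add: unitary_group_carrier)
    show "ennreal (exp (2 * real k * x)) * indicator S U \<le> (\<Sum>j<D. ennreal (cmod (Lambda U (t j)) ^ (2 * k)))"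
    proof (cases "U \<in> S")
      case True
      then have "exp x ^ (2 * k) \<le> max_Lambda U ^ (2 * k)" by (intro power_mono) (auto simp: S_def)
      also have "\<dots> \<le> (\<Sum>j<D. cmod (Lambda U (t j)) ^ (2 * k))"
        unfolding D_def t_def by (rule max_Lambda_power_le[OF U])
      also have "exp x ^ (2 * k) = exp (2 * real k * x)" by (simp flip: exp_of_nat_mult)
      finally show ?thesis using True by (simp add: sum_ennreal ennreal_leI)
    qed simp
  qed
  also have "\<dots> = (\<Sum>j<D. \<integral>\<^sup>+U. ennreal (cmod (Lambda U (t j)) ^ (2 * k)) \<partial>\<mu>)"
    by (rule nn_integral_sum) measurable
  also have "\<dots> = ennreal (real D * det_moment N k)"
    unfolding M by (simp add: ennreal_mult ennreal_of_nat_eq_real_of_nat det_moment_nonneg)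
  finally have "exp (2 * real k * x) * prob S \<le> real D * det_moment N k"
    using det_moment_nonneg[of N k] by (subst (asm) ennreal_le_iff) auto
  then have "prob S \<le> real D * det_moment N k * exp (- (2 * real k * x))"
    by (simp add: exp_minus field_simps)
  then show ?thesis by (simp add: S_def D_def)
qed

text \<open>A change of measure without the normalisation. Let \<open>X\<close> be the modulus at
  angle \<open>0\<close>. Where \<open>X\<close> is below \<open>exp x\<close>, the factor
  \<open>X ^ (2 * h)\<close> is replaced by its bound; where it is above \<open>exp y\<close>, such
  a factor is gained. What remains lies in the event, with \<open>X ^ (2 * k)\<close> at most
  \<open>exp (2 * real k * y)\<close>. Once the first two terms are small against the moment, the
  probability is bounded below.\<close>

lemma prob_max_Lambda_ge:
  assumes M: "\<And>k. (\<integral>\<^sup>+U. ennreal (cmod (Lambda U 0) ^ (2 * k)) \<partial>\<mu>) = ennreal (det_moment N k)"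
    and "h \<le> k"
  shows "det_moment N k \<le> exp (2 * real h * x) * det_moment N (k - h) +
    exp (- 2 * real h * y) * det_moment N (k + h) +
    exp (2 * real k * y) * prob {U \<in> space \<mu>. exp x \<le> max_Lambda U}"
proof -
  define S where "S = {U \<in> space \<mu>. exp x \<le> max_Lambda U}"
  have S [measurable]: "S \<in> sets \<mu>" unfolding S_def by (rule sets_max_Lambda_ge)
  have pw: "exp z ^ (2 * n) = exp (2 * real n * z)" for z :: real and n
    by (simp flip: exp_of_nat_mult)
  have "ennreal (det_moment N k) = (\<integral>\<^sup>+U. ennreal (cmod (Lambda U 0) ^ (2 * k)) \<partial>\<mu>)" by (simp add: M)
  also have "\<dots> \<le> (\<integral>\<^sup>+U. ennreal (exp (2 * real h * x)) * ennreal (cmod (Lambda U 0) ^ (2 * (k - h))) +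
      ennreal (exp (- 2 * real h * y)) * ennreal (cmod (Lambda U 0) ^ (2 * (k + h))) +
      ennreal (exp (2 * real k * y)) * indicator S U \<partial>\<mu>)"
  proof (intro nn_integral_mono)
    fix U assume U: "U \<in> space \<mu>"
    define X where "X = cmod (Lambda U 0)"
    have X0: "X \<ge> 0" by (simp add: X_def)
    have XS: "U \<in> S" if "exp x \<le> X"
      using that U max_Lambda_ge[OF unitary_group_carrier, of U N 0] by (simp add: S_def X_def)
    have "X ^ (2 * k) \<le> exp (2 * real h * x) * X ^ (2 * (k - h)) + exp (- 2 * real h * y) * X ^ (2 * (k + h)) +
        exp (2 * real k * y) * indicator S U"
    proof -
      have nn: "0 \<le> exp (2 * real h * x) * X ^ (2 * (k - h))" "0 \<le> exp (- 2 * real h * y) * X ^ (2 * (k + h))"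
        "0 \<le> exp (2 * real k * y) * indicator S U"
        using X0 by auto
      consider "X < exp x" | "exp x \<le> X" "X \<le> exp y" | "exp y < X" by linarith
      then show ?thesis
      proof cases
        case 1
        have "X ^ (2 * k) = X ^ (2 * h) * X ^ (2 * (k - h))"
          using \<open>h \<le> k\<close> by (simp flip: power_add distrib_left)
        also have "\<dots> \<le> exp x ^ (2 * h) * X ^ (2 * (k - h))"
          using 1 X0 by (intro mult_right_mono power_mono) auto
        finally show ?thesis using nn unfolding pw by linarith
      next
        case 2
        have "X ^ (2 * k) \<le> exp y ^ (2 * k)" using 2 X0 by (intro power_mono) auto
        also have "\<dots> = exp (2 * real k * y) * indicator S U" using XS[OF 2(1)] pw by simp
        finally show ?thesis using nn by linarith
      next
        case 3
        have "exp (2 * real h * y) * X ^ (2 * k) \<le> X ^ (2 * h) * X ^ (2 * k)"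
          unfolding pw[symmetric] using 3 X0 by (intro mult_right_mono power_mono) auto
        also have "\<dots> = X ^ (2 * (k + h))" by (simp add: distrib_left power_add)
        finally have "X ^ (2 * k) \<le> exp (- 2 * real h * y) * X ^ (2 * (k + h))"
          by (simp add: exp_minus field_simps)
        then show ?thesis using nn by linarith
      qed
    qed
    then have "ennreal (X ^ (2 * k)) \<le> ennreal (exp (2 * real h * x) * X ^ (2 * (k - h)) +
        exp (- 2 * real h * y) * X ^ (2 * (k + h)) + exp (2 * real k * y) * indicator S U)"
      by (rule ennreal_leI)
    also have "\<dots> = ennreal (exp (2 * real h * x)) * ennreal (X ^ (2 * (k - h))) +
      ennreal (exp (- 2 * real h * y)) * ennreal (X ^ (2 * (k + h))) +
      ennreal (exp (2 * real k * y)) * indicator S U"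
      using X0 by (simp add: ennreal_mult ennreal_plus ennreal_indicator)
    finally show "ennreal (cmod (Lambda U 0) ^ (2 * k)) \<le>
      ennreal (exp (2 * real h * x)) * ennreal (cmod (Lambda U 0) ^ (2 * (k - h))) +
      ennreal (exp (- 2 * real h * y)) * ennreal (cmod (Lambda U 0) ^ (2 * (k + h))) +
      ennreal (exp (2 * real k * y)) * indicator S U" unfolding X_def .
  qed
  also have "\<dots> = ennreal (exp (2 * real h * x)) * ennreal (det_moment N (k - h)) +
      ennreal (exp (- 2 * real h * y)) * ennreal (det_moment N (k + h)) +
      ennreal (exp (2 * real k * y)) * ennreal (prob S)"
    using M[of "k + h"] by (simp add: nn_integral_add nn_integral_cmult M emeasure_eq_measure)
  also have "\<dots> = ennreal (exp (2 * real h * x) * det_moment N (k - h) +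
      exp (- 2 * real h * y) * det_moment N (k + h) + exp (2 * real k * y) * prob S)"
    by (simp add: ennreal_mult ennreal_plus det_moment_nonneg)
  finally show ?thesis
    unfolding S_def by (subst (asm) ennreal_le_iff) (auto intro!: add_nonneg_nonneg mult_nonneg_nonneg det_moment_nonneg)
qed

end

section \<open>Asymptotics\<close>

text \<open>A single term of the exponential series is at most its sum; this is the part of
  Stirling's formula that the moment estimate uses.\<close>

lemma power_le_fact_exp: "real k ^ k \<le> fact k * exp (real k)"
proof -
  have "(\<Sum>n\<in>{k}. real k ^ n /\<^sub>R fact n) \<le> (\<Sum>n. real k ^ n /\<^sub>R fact n)"
    by (intro sum_le_suminf summable_exp_generic) auto
  then show ?thesis by (simp add: exp_def field_simps)
qed

text \<open>There are \<open>k\<^sup>2\<close> factors. Each is at least \<open>N / (2 * k)\<close>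
  and at most \<open>2 * N / (i + 1)\<close>; the upper denominators multiply to powers of
  \<open>fact k\<close>, which is at least \<open>(k / exp 1) ^ k\<close>. So each factor is
  \<open>N / k\<close> on average, up to \<open>ln 2\<close> below and \<open>ln 2 + 1\<close> above
  in the logarithm.\<close>

lemma det_moment_bounds:
  assumes "1 \<le> k" "2 * k \<le> N"
  shows "0 < det_moment N k"
    and "\<bar>ln (det_moment N k) - (real k)\<^sup>2 * ln (real N / real k)\<bar> \<le> 2 * (real k)\<^sup>2"
proof -
  have pos: "real N > 0" "real k > 0" using assms by auto
  show gt: "0 < det_moment N k"
    unfolding det_moment_def by (intro prod_pos ballI) auto
  have "(real N / (2 * real k)) ^ k ^ 2 = (\<Prod>i<k. \<Prod>l<k. real N / (2 * real k))"
    by (simp add: power2_eq_square power_mult)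
  also have "\<dots> \<le> det_moment N k"
    unfolding det_moment_def
  proof (intro prod_mono conjI prod_nonneg ballI)
    fix i l assume "i \<in> {..<k}" "l \<in> {..<k}"
    then have "real (i + l + 1) \<le> 2 * real k" by auto
    then show "real N / (2 * real k) \<le> real (N + i + l + 1) / real (i + l + 1)"
      using pos by (intro frac_le) auto
  qed auto
  finally have "ln ((real N / (2 * real k)) ^ k ^ 2) \<le> ln (det_moment N k)"
    using pos gt by (subst ln_le_cancel_iff) auto
  then have "(real k)\<^sup>2 * (ln (real N / real k) - ln 2) \<le> ln (det_moment N k)"
    using pos by (simp add: ln_realpow ln_div ln_mult algebra_simps)
  moreover have "(real k)\<^sup>2 * ln 2 \<le> (real k)\<^sup>2 * 2"
    by (intro mult_left_mono) (use ln_le_minus_one[of 2] in auto)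
  ultimately have lower: "(real k)\<^sup>2 * ln (real N / real k) - 2 * (real k)\<^sup>2 \<le> ln (det_moment N k)"
    by (simp add: algebra_simps)
  have "det_moment N k \<le> (\<Prod>i<k. \<Prod>l<k. 2 * real N / real (i + 1))"
    unfolding det_moment_def
  proof (intro prod_mono conjI prod_nonneg ballI)
    fix i l assume "i \<in> {..<k}" "l \<in> {..<k}"
    then have "real (N + i + l + 1) \<le> 2 * real N" using assms by auto
    then show "real (N + i + l + 1) / real (i + l + 1) \<le> 2 * real N / real (i + 1)"
      by (intro frac_le) auto
  qed auto
  also have "\<dots> = (\<Prod>i<k. 2 * real N / real (i + 1)) ^ k"
    by (simp add: prod_power_distrib)
  finally have det_le: "det_moment N k \<le> (\<Prod>i<k. 2 * real N / real (i + 1)) ^ k" .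
  have "(\<Prod>i<k. 2 * real N / real (i + 1)) = (2 * real N) ^ k / fact k"
  proof -
    have "(\<Prod>i<k. c / real (i + 1)) = c ^ k / fact k" for c
      by (induction k) (simp_all add: mult_ac add_ac)
    then show ?thesis .
  qed
  also have "\<dots> \<le> (2 * real N) ^ k / (real k ^ k / exp (real k))"
    using power_le_fact_exp[of k] pos by (intro divide_left_mono) (auto simp: field_simps)
  also have "\<dots> = (2 * real N * exp 1 / real k) ^ k"
    by (simp add: power_divide power_mult_distrib flip: exp_of_nat_mult)
  finally have "(\<Prod>i<k. 2 * real N / real (i + 1)) ^ k \<le> ((2 * real N * exp 1 / real k) ^ k) ^ k"
    by (intro power_mono prod_nonneg) auto
  with det_le have "det_moment N k \<le> ((2 * real N * exp 1 / real k) ^ k) ^ k" by linarith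
  then have "ln (det_moment N k) \<le> ln (((2 * real N * exp 1 / real k) ^ k) ^ k)"
    using pos gt by (subst ln_le_cancel_iff) auto
  also have "\<dots> = (real k)\<^sup>2 * (ln (real N / real k) + ln 2 + 1)"
    using pos by (simp add: ln_realpow ln_div ln_mult algebra_simps power2_eq_square)
  also have "\<dots> \<le> (real k)\<^sup>2 * (ln (real N / real k) + 2)"
    by (intro mult_left_mono) (use ln_le_minus_one[of 2] in auto)
  finally show "\<bar>ln (det_moment N k) - (real k)\<^sup>2 * ln (real N / real k)\<bar> \<le> 2 * (real k)\<^sup>2"
    using lower by (simp add: algebra_simps)
qed

section \<open>Optimising the exponent\<close>

text \<open>If \<open>G k\<close> is about \<open>exp (k\<^sup>2 * B)\<close>, the Markov exponent
  \<open>k\<^sup>2 * B - 2 * k * x\<close> is least at \<open>k = x / B = q\<close>, with value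
  \<open>- A\<close>. Rounding, the error in \<open>ln (G k)\<close> and the polynomial factor are
  all measured in units of \<open>A\<close> and bounded through \<open>s\<close>, which is chosen
  small against the gain \<open>\<eta>\<^sup>2\<close> from concentration.\<close>

lemma tail_bounds_of_moment_bounds:
  fixes G :: "nat \<Rightarrow> real" and q B s \<eta> P :: real
  defines "A \<equiv> q\<^sup>2 * B" and "x \<equiv> q * B"
  assumes \<eta>: "0 < \<eta>" "\<eta> \<le> 1" and s: "s = \<eta>\<^sup>2 / 12" and B: "0 < B"
    and q: "1 \<le> s * q" and A: "2 \<le> s * A"
    and G: "\<And>k. q / 2 \<le> real k \<Longrightarrow> real k \<le> 4 * q \<Longrightarrow> 0 < G k \<and> \<bar>ln (G k) - (real k)\<^sup>2 * B\<bar> \<le> s * A"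
    and N: "\<And>k. real k \<le> q \<Longrightarrow> ln (real (k * N + 1)) \<le> s * A"
    and upper: "\<And>k. P \<le> real (k * N + 1) * G k * exp (- 2 * real k * x)"
    and lower: "\<And>k h y. h \<le> k \<Longrightarrow> x \<le> y \<Longrightarrow>
      G k \<le> exp (2 * real h * x) * G (k - h) + exp (- 2 * real h * y) * G (k + h) + exp (2 * real k * y) * P"
  shows "exp (- A * (1 + 10 * \<eta>)) \<le> P" and "P \<le> exp (- A * (1 - 10 * \<eta>))"
proof -
  have sb: "0 < s" "s \<le> 1 / 12" "s \<le> \<eta> / 12"
    using \<eta> mult_left_le[of \<eta> \<eta>] mult_le_one[of \<eta> \<eta>] by (auto simp: s power2_eq_square)
  have q12: "q \<ge> 12"
  proof (rule ccontr)
    assume "\<not> q \<ge> 12"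
    then have "s * q < 1 / 12 * 12 \<or> q < 0"
      using sb mult_strict_mono[of s "1/12" q 12] mult_le_less_imp_less[of s "1/12" q 12] by linarith
    with q sb show False using mult_pos_neg[of s q] by linarith
  qed
  then have q0: "q > 0" by simp
  have A0: "A > 0" using q0 B by (simp add: A_def)
  \<comment> \<open>The optimal order and the shift, both rounded down; rounding moves the
    normalised values \<open>\<mu>\<close> and \<open>\<theta>\<close> by at most
    \<open>1 / q\<close>, hence by at most \<open>s\<close>.\<close>
  define m where "m = nat \<lfloor>q\<rfloor>"
  define h where "h = nat \<lfloor>\<eta> * q\<rfloor>"
  define \<mu> where "\<mu> = real m / q"
  define \<theta> where "\<theta> = real h / q"
  have inv: "1 / q \<le> s" using q q0 by (simp add: field_simps)
  have "q - 1 \<le> real m" "real m \<le> q" using q0 unfolding m_def by linarith+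
  then have m: "1 - s \<le> \<mu>" "\<mu> \<le> 1"
    using inv q0 unfolding \<mu>_def by (simp_all add: field_simps)
  have "\<eta> * q > 0" using \<eta> q0 by simp
  then have "\<eta> * q - 1 \<le> real h" "real h \<le> \<eta> * q" unfolding h_def by linarith+
  then have t: "\<eta> - s \<le> \<theta>" "\<theta> \<le> \<eta>"
    using inv q0 unfolding \<theta>_def by (simp_all add: field_simps)
  have t0: "0 \<le> \<theta>" using q0 by (simp add: \<theta>_def)
  have mq: "real m = \<mu> * q" and hq: "real h = \<theta> * q" using q0 by (simp_all add: \<mu>_def \<theta>_def)
  have lnG: "exp (A * (c\<^sup>2 - s)) \<le> G k" "G k \<le> exp (A * (c\<^sup>2 + s))" "0 < G k"
    if "real k = c * q" "1 / 2 \<le> c" "c \<le> 4" for k c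
  proof -
    have "q / 2 \<le> real k" "real k \<le> 4 * q" using that q0 by simp_all
    note * = G[OF this]
    have eq: "(real k)\<^sup>2 * B = A * c\<^sup>2" by (simp add: that A_def power_mult_distrib)
    from * show "0 < G k" by simp
    have "A * (c\<^sup>2 - s) \<le> ln (G k)" "ln (G k) \<le> A * (c\<^sup>2 + s)"
      using * unfolding eq by (auto simp: algebra_simps)
    with \<open>0 < G k\<close> show "exp (A * (c\<^sup>2 - s)) \<le> G k" "G k \<le> exp (A * (c\<^sup>2 + s))"
      by (metis exp_le_cancel_iff exp_ln)+
  qed
  have xk: "real k * x = A * c" if "real k = c * q" for k c
    by (simp add: that A_def x_def power2_eq_square)
  show "P \<le> exp (- A * (1 - 10 * \<eta>))"
  proof -
    have "real (m * N + 1) \<le> exp (s * A)"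
    proof -
      have "0 < real (m * N + 1)" by (simp only: of_nat_0_less_iff)
      then have "real (m * N + 1) = exp (ln (real (m * N + 1)))" by (rule exp_ln[symmetric])
      also have "\<dots> \<le> exp (s * A)" using N[OF \<open>real m \<le> q\<close>] by (simp only: exp_le_cancel_iff)
      finally show ?thesis .
    qed
    then have "P \<le> exp (s * A) * exp (A * (\<mu>\<^sup>2 + s)) * exp (- 2 * real m * x)"
      using lnG[OF mq] m sb by (intro order_trans[OF upper[of m]] mult_right_mono mult_mono) auto
    also have "\<dots> = exp (s * A + A * (\<mu>\<^sup>2 + s) - 2 * (real m * x))"
      by (simp add: algebra_simps flip: exp_add)
    \<comment> \<open>Completing the square: \<open>(1 - \<mu>)\<^sup>2\<close> is the loss from
      rounding, and the two \<open>s\<close> are the polynomial factor and the error in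
      \<open>ln (G m)\<close>.\<close>
    also have "\<dots> = exp (A * ((1 - \<mu>)\<^sup>2 + 2 * s - 1))"
      unfolding xk[OF mq] by (simp add: power2_eq_square algebra_simps)
    also have "\<dots> \<le> exp (A * (10 * \<eta> - 1))"
    proof -
      have "(1 - \<mu>)\<^sup>2 \<le> 1 - \<mu>" using m sb by (simp add: power2_eq_square mult_left_le)
      then show ?thesis using m sb A0 \<eta> by simp
    qed
    finally show ?thesis by (simp add: algebra_simps)
  qed
  show "exp (- A * (1 + 10 * \<eta>)) \<le> P"
  proof -
    \<comment> \<open>Under the measure tilted by the power \<open>2 * k\<close>, the logarithm has
      mean about \<open>\<kappa> * x\<close>, close to \<open>(1 + \<eta>) * x\<close>; the window
      from \<open>x\<close> to \<open>y\<close> is centred there.\<close>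
    define k where "k = m + h"
    define \<kappa> where "\<kappa> = \<mu> + \<theta>"
    define y where "y = (1 + 2 * \<eta>) * x"
    have kq: "real k = \<kappa> * q" by (simp add: k_def \<kappa>_def mq hq algebra_simps)
    have khq: "real (k + h) = (\<mu> + 2 * \<theta>) * q" by (simp add: k_def mq hq algebra_simps)
    have \<kappa>: "1 / 2 \<le> \<kappa>" "\<kappa> \<le> 1 + \<eta>" using m t t0 sb by (auto simp: \<kappa>_def)
    have "x \<ge> 0" using q0 B by (simp add: x_def)
    then have "x \<le> y" using \<eta> by (simp add: y_def mult_le_cancel_right1)
    have yk: "real n * y = A * (c * (1 + 2 * \<eta>))" if "real n = c * q" for n c
      using xk[OF that] by (simp add: y_def mult.left_commute mult.assoc)
    note Gk = lnG[OF kq \<kappa>(1)]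
    have \<kappa>4: "\<kappa> \<le> 4" using \<kappa> \<eta> by simp
    \<comment> \<open>By the choice of \<open>s\<close>, \<open>\<eta>\<^sup>2 - 6 * s\<close>
      equals \<open>6 * s\<close>, so the assumption on \<open>s * A\<close> makes the exponent at
      most \<open>- 12\<close>.\<close>
    have quarter: "exp (- (A * (\<eta>\<^sup>2 - 6 * s))) \<le> 1 / 4"
    proof -
      have "A * (\<eta>\<^sup>2 - 6 * s) = 6 * (s * A)" by (simp add: s)
      then have "12 \<le> A * (\<eta>\<^sup>2 - 6 * s)" using A by linarith
      then have "exp (- (A * (\<eta>\<^sup>2 - 6 * s))) \<le> exp (- 12)" by (simp only: exp_le_cancel_iff neg_le_iff_le)
      also have "\<dots> \<le> 1 / 4"
      proof -
        have "(4 :: real) \<le> exp 12" using exp_ge_add_one_self[of "12 :: real"] by simp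
        then show ?thesis by (simp add: exp_minus field_simps)
      qed
      finally show ?thesis .
    qed
    have ss: "(\<eta> - s)\<^sup>2 \<le> \<theta>\<^sup>2" using t sb \<eta> by (intro power_mono) auto
    have es: "\<eta> * s \<le> s" using \<eta> sb by simp
    \<comment> \<open>Compared with \<open>\<kappa>\<^sup>2\<close> the exponent drops by
      \<open>\<theta>\<^sup>2 - 2 * \<theta> * (1 - \<mu>)\<close>, which is
      \<open>\<eta>\<^sup>2\<close> up to rounding.\<close>
    have T1: "exp (2 * real h * x) * G (k - h) \<le> G k / 4"
    proof -
      have "exp (2 * real h * x) * G (k - h) \<le> exp (2 * (real h * x)) * exp (A * (\<mu>\<^sup>2 + s))"
        using lnG[OF mq] m sb by (simp add: k_def mult.assoc)
      also have "\<dots> = exp (A * (2 * \<theta> + \<mu>\<^sup>2 + s))"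
        unfolding xk[OF hq] by (simp add: algebra_simps flip: exp_add)
      also have "\<dots> \<le> exp (A * (\<kappa>\<^sup>2 - s) - A * (\<eta>\<^sup>2 - 6 * s))"
      proof -
        have "\<theta> * (1 - \<mu>) \<le> \<eta> * s" using m t t0 \<eta> by (intro mult_mono) auto
        then have "2 * \<theta> + \<mu>\<^sup>2 + s \<le> \<kappa>\<^sup>2 - s - (\<eta>\<^sup>2 - 6 * s)"
          using ss es sb zero_le_power2[of s]
          unfolding \<kappa>_def power2_sum power2_diff right_diff_distrib mult.assoc mult.commute[of \<mu> \<theta>] by linarith
        from mult_left_mono[OF this less_imp_le[OF A0]] show ?thesis
          by (simp only: exp_le_cancel_iff right_diff_distrib)
      qed
      also have "\<dots> = exp (A * (\<kappa>\<^sup>2 - s)) * exp (- (A * (\<eta>\<^sup>2 - 6 * s)))"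
        by (simp flip: exp_add)
      also have "\<dots> \<le> G k * (1 / 4)" using Gk \<kappa>4 quarter by (intro mult_mono) auto
      finally show ?thesis by simp
    qed
    \<comment> \<open>Here the drop is \<open>2 * \<theta> * (1 - \<mu>) + \<theta> * (4 * \<eta> -
      3 * \<theta>)\<close>, at least \<open>\<theta> * \<eta>\<close> because
      \<open>\<theta> \<le> \<eta>\<close>.\<close>
    have T2: "exp (- 2 * real h * y) * G (k + h) \<le> G k / 4"
    proof -
      have "exp (- 2 * real h * y) * G (k + h) \<le> exp (- 2 * (real h * y)) * exp (A * ((\<mu> + 2 * \<theta>)\<^sup>2 + s))"
        using lnG(2)[OF khq] m t t0 sb \<eta> by (simp add: mult.assoc)
      also have "\<dots> = exp (A * ((\<mu> + 2 * \<theta>)\<^sup>2 + s - 2 * \<theta> * (1 + 2 * \<eta>)))"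
        unfolding yk[OF hq] by (simp add: algebra_simps flip: exp_add)
      also have "\<dots> \<le> exp (A * (\<kappa>\<^sup>2 - s) - A * (\<eta>\<^sup>2 - 6 * s))"
      proof -
        have "\<theta> * \<mu> \<le> \<theta> * 1" "\<theta> * \<theta> \<le> \<theta> * \<eta>" "(\<eta> - s) * \<eta> \<le> \<theta> * \<eta>"
          using m t t0 \<eta> by (intro mult_left_mono mult_right_mono; linarith)+
        moreover have "(\<mu> + 2 * \<theta>)\<^sup>2 = \<mu>\<^sup>2 + 4 * (\<theta> * \<mu>) + 4 * (\<theta> * \<theta>)"
          "\<kappa>\<^sup>2 = \<mu>\<^sup>2 + 2 * (\<theta> * \<mu>) + \<theta> * \<theta>" "2 * \<theta> * (1 + 2 * \<eta>) = 2 * \<theta> + 4 * (\<theta> * \<eta>)"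
          "(\<eta> - s) * \<eta> = \<eta>\<^sup>2 - \<eta> * s"
          by (simp_all add: \<kappa>_def power2_eq_square algebra_simps)
        ultimately have "(\<mu> + 2 * \<theta>)\<^sup>2 + s - 2 * \<theta> * (1 + 2 * \<eta>) \<le> \<kappa>\<^sup>2 - s - (\<eta>\<^sup>2 - 6 * s)"
          using es sb by linarith
        from mult_left_mono[OF this less_imp_le[OF A0]] show ?thesis
          by (simp only: exp_le_cancel_iff right_diff_distrib)
      qed
      also have "\<dots> = exp (A * (\<kappa>\<^sup>2 - s)) * exp (- (A * (\<eta>\<^sup>2 - 6 * s)))"
        by (simp flip: exp_add)
      also have "\<dots> \<le> G k * (1 / 4)" using Gk \<kappa>4 quarter by (intro mult_mono) auto
      finally show ?thesis by simp
    qed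
    have "G k \<le> exp (2 * real h * x) * G (k - h) + exp (- 2 * real h * y) * G (k + h) + exp (2 * real k * y) * P"
      by (rule lower) (use \<open>x \<le> y\<close> in \<open>auto simp: k_def\<close>)
    \<comment> \<open>The two tails take at most half of \<open>G k\<close>, so the event carries
      the other half.\<close>
    with T1 T2 have "G k / 2 \<le> exp (2 * (real k * y)) * P" by (simp add: mult.assoc)
    then have "G k \<le> 2 * exp (A * (2 * \<kappa> * (1 + 2 * \<eta>))) * P"
      unfolding yk[OF kq] by (simp add: mult_ac)
    with Gk(1)[OF \<kappa>4] have "exp (A * (\<kappa>\<^sup>2 - s)) \<le> 2 * exp (A * (2 * \<kappa> * (1 + 2 * \<eta>))) * P" by simp
    \<comment> \<open>Since \<open>2 * \<kappa> \<le> \<kappa>\<^sup>2 + 1\<close> and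
      \<open>\<kappa> \<le> 2\<close>, the exponents leave room
      \<open>2 * \<eta> \<ge> 2 * s\<close>; one \<open>s\<close> matches the left side and the
      other absorbs the factor 2 through \<open>exp (s * A) \<ge> 2\<close>.\<close>
    moreover have "exp (A * (\<kappa>\<^sup>2 - s)) \<ge> 2 * exp (A * (2 * \<kappa> * (1 + 2 * \<eta>))) * exp (- A * (1 + 10 * \<eta>))"
    proof -
      have "2 * \<kappa> * (1 + 2 * \<eta>) = \<kappa>\<^sup>2 + 1 - (1 - \<kappa>)\<^sup>2 + 4 * (\<kappa> * \<eta>)"
        by (simp add: power2_eq_square algebra_simps)
      also have "\<dots> \<le> \<kappa>\<^sup>2 + 1 + 4 * (2 * \<eta>)"
        using \<kappa> \<eta> by (intro add_mono mult_left_mono mult_right_mono) auto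
      finally have "2 * \<kappa> * (1 + 2 * \<eta>) - (1 + 10 * \<eta>) \<le> \<kappa>\<^sup>2 - s - s" using sb \<eta> by simp
      from mult_left_mono[OF this, of A]
      have "A * (2 * \<kappa> * (1 + 2 * \<eta>)) - A * (1 + 10 * \<eta>) + s * A \<le> A * (\<kappa>\<^sup>2 - s)"
        using A0 by (simp add: algebra_simps)
      then have "exp (s * A) * (exp (A * (2 * \<kappa> * (1 + 2 * \<eta>))) * exp (- A * (1 + 10 * \<eta>))) \<le> exp (A * (\<kappa>\<^sup>2 - s))"
        by (simp add: add_ac flip: exp_add)
      moreover have "2 \<le> exp (s * A)" using A exp_ge_add_one_self[of "s * A"] by linarith
      then have "2 * (exp (A * (2 * \<kappa> * (1 + 2 * \<eta>))) * exp (- A * (1 + 10 * \<eta>))) \<le>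
          exp (s * A) * (exp (A * (2 * \<kappa> * (1 + 2 * \<eta>))) * exp (- A * (1 + 10 * \<eta>)))"
        by (intro mult_right_mono) auto
      ultimately show ?thesis by (simp only: mult.assoc)
    qed
    ultimately have "2 * exp (A * (2 * \<kappa> * (1 + 2 * \<eta>))) * exp (- A * (1 + 10 * \<eta>)) \<le>
        2 * exp (A * (2 * \<kappa> * (1 + 2 * \<eta>))) * P" by linarith
    then show ?thesis by (subst (asm) mult_le_cancel_left_pos) auto
  qed
qed

text \<open>By the choice of \<open>q\<close>, \<open>ln (N / q)\<close> is \<open>B + ln B\<close>,
  so for \<open>k\<close> comparable to \<open>q\<close> the moment exponent is
  \<open>k\<^sup>2 * B\<close> up to a relative error of order \<open>ln B / B\<close>. Uniformity
  in \<open>lam\<close> comes from \<open>B \<ge> \<delta> * ln N\<close> and from enclosing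
  \<open>N powr lam\<close> between \<open>N powr \<delta>\<close> and
  \<open>N powr (1 - \<delta>)\<close>.\<close>

lemma eventually_moment_regime:
  fixes \<delta> s :: real
  assumes "0 < \<delta>" "0 < s"
  shows "\<forall>\<^sub>F N in sequentially. \<forall>lam\<in>{\<delta>..1 - \<delta>}. \<forall>B q.
    B = (1 - lam) * ln (real N) \<longrightarrow> q = real N powr lam / B \<longrightarrow>
    0 < B \<and> 1 \<le> s * q \<and> 2 \<le> s * (q\<^sup>2 * B) \<and>
    (\<forall>k. q / 2 \<le> real k \<longrightarrow> real k \<le> 4 * q \<longrightarrow>
      0 < det_moment N k \<and> \<bar>ln (det_moment N k) - (real k)\<^sup>2 * B\<bar> \<le> s * (q\<^sup>2 * B)) \<and>
    (\<forall>k. real k \<le> q \<longrightarrow> ln (real (k * N + 1)) \<le> s * (q\<^sup>2 * B))"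
proof -
  \<comment> \<open>The \<open>16\<close> is the square in \<open>k \<le> 4 * q\<close>; half of the
    \<open>4\<close> bounds \<open>ln (k / q)\<close> and half is the error in
    \<open>det_moment_bounds\<close>.\<close>
  have "\<forall>\<^sub>F B in at_top. 16 * (\<bar>ln B\<bar> + 4) \<le> s * B" using assms by real_asymp
  then obtain B0 where B0: "\<And>B. B \<ge> B0 \<Longrightarrow> 16 * (\<bar>ln B\<bar> + 4) \<le> s * B"
    by (auto simp: eventually_at_top_linorder)
  have "\<forall>\<^sub>F N in sequentially. max B0 1 \<le> \<delta> * ln (real N)" using assms by real_asymp
  moreover have "\<forall>\<^sub>F N in sequentially. 1 \<le> s * (real N powr \<delta> / ln (real N))" using assms by real_asymp
  moreover have "\<forall>\<^sub>F N in sequentially. 1 \<le> real N powr \<delta> / ln (real N)" using assms by real_asymp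
  \<comment> \<open>This yields \<open>8 * q \<le> N\<close>, hence \<open>2 * k \<le> N\<close> for
    every \<open>k \<le> 4 * q\<close>, as the moment estimate requires.\<close>
  moreover have "\<forall>\<^sub>F N in sequentially. 8 * (real N powr (1 - \<delta>) / (\<delta> * ln (real N))) \<le> real N" using assms by real_asymp
  \<comment> \<open>The \<open>3\<close> is the exponent in
    \<open>k * N + 1 \<le> N ^ 3\<close>.\<close>
  moreover have "\<forall>\<^sub>F N in sequentially. 3 * ln (real N) \<le> s * real N powr \<delta>" using assms by real_asymp
  moreover have "\<forall>\<^sub>F N in sequentially. 3 \<le> N" by (rule eventually_ge_at_top)
  ultimately show ?thesis
  proof eventually_elim
    case (elim N)
    define L where "L = ln (real N)"
    have N3: "3 \<le> real N" using elim by simp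
    have "exp 1 \<le> real N" using N3 exp_le by linarith
    then have L: "L \<ge> 1" using N3 by (simp add: L_def ln_ge_iff)
    show ?case
    proof (intro ballI allI impI, goal_cases)
      case (1 lam B q)
      then have lam: "\<delta> \<le> lam" "lam \<le> 1 - \<delta>" by auto
      have B: "B = (1 - lam) * L" using 1 by (simp add: L_def)
      have BL: "B \<le> L" "\<delta> * L \<le> B"
        using lam assms L unfolding B by (simp_all add: mult_le_cancel_right1 mult_right_mono)
      have B1: "B \<ge> 1" "B \<ge> B0" using elim(1) BL by (auto simp: L_def)
      then have Bp: "B > 0" by simp
      have dL: "\<delta> * L > 0" using assms L by simp
      define x where "x = real N powr lam"
      have x: "x = q * B" using Bp 1(3) by (simp add: x_def)
      have "x / B \<ge> real N powr \<delta> / L"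
        unfolding x_def using BL Bp lam N3 by (intro frac_le powr_mono) auto
      then have qL: "q \<ge> real N powr \<delta> / L" using Bp by (simp add: x)
      then have q1: "q \<ge> 1" using elim(3) by (simp add: L_def)
      have "q = x / B" using Bp by (simp add: x)
      also have "\<dots> \<le> real N powr (1 - \<delta>) / (\<delta> * L)"
        unfolding x_def using BL dL lam N3 by (intro frac_le powr_mono) auto
      finally have q8: "8 * q \<le> real N" using elim(4) by (simp add: L_def)
      have sq: "1 \<le> s * q"
        using elim(2) mult_left_mono[OF qL, of s] assms by (simp add: L_def)
      have "q\<^sup>2 * B = q * x" by (simp add: x power2_eq_square)
      moreover have "1 * x \<le> q * x" using q1 by (intro mult_right_mono) (auto simp: x_def)
      moreover have "real N powr \<delta> \<le> x" unfolding x_def using lam N3 by (intro powr_mono) auto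
      ultimately have "real N powr \<delta> \<le> q\<^sup>2 * B" by simp
      from mult_left_mono[OF this less_imp_le[OF assms(2)]] have sA: "3 * L \<le> s * (q\<^sup>2 * B)"
        using elim(5) unfolding L_def by linarith
      have G: "0 < det_moment N k \<and> \<bar>ln (det_moment N k) - (real k)\<^sup>2 * B\<bar> \<le> s * (q\<^sup>2 * B)"
        if k: "q / 2 \<le> real k" "real k \<le> 4 * q" for k
      proof -
        have kp: "real k > 0" using k q1 by linarith
        then have "1 \<le> k" "2 * k \<le> N" using k q8 by auto
        note bd = det_moment_bounds[OF this]
        have lnx: "ln x = lam * L" using N3 by (simp add: x_def L_def ln_powr)
        have "ln q = ln x - ln B" using x q1 Bp by (simp add: ln_mult)
        \<comment> \<open>\<open>ln N - lam * ln N\<close> is exactly \<open>B\<close>, which leaves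
          only the corrections from dividing by \<open>B\<close> and from
          \<open>k / q\<close>.\<close>
        then have "ln (real N / real k) - B = ln B - ln (real k / q)"
          using kp q1 N3 by (simp add: ln_div lnx B L_def algebra_simps)
        moreover have "\<bar>ln (real k / q)\<bar> \<le> 2"
        proof -
          have r: "1 / 2 \<le> real k / q" "real k / q \<le> 4" using k q1 by (simp_all add: field_simps)
          have "ln (real k / q) \<le> ln 4" by (subst ln_le_cancel_iff) (use r in linarith)+
          moreover have "ln (1 / 2) \<le> ln (real k / q)" by (subst ln_le_cancel_iff) (use r in linarith)+
          moreover have "ln (2 :: real) \<le> 1" using ln_le_minus_one[of 2] by simp
          moreover have "ln (4 :: real) = 2 * ln 2" using ln_realpow[of 2 2] by simp
          moreover have "ln (1 / 2 :: real) = - ln 2" by (simp add: ln_div)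
          ultimately show ?thesis by linarith
        qed
        ultimately have "\<bar>ln (real N / real k) - B\<bar> \<le> \<bar>ln B\<bar> + 2" by linarith
        then have "(real k)\<^sup>2 * \<bar>ln (real N / real k) - B\<bar> \<le> (real k)\<^sup>2 * (\<bar>ln B\<bar> + 2)"
          by (intro mult_left_mono) auto
        then have "\<bar>(real k)\<^sup>2 * ln (real N / real k) - (real k)\<^sup>2 * B\<bar> \<le> (real k)\<^sup>2 * (\<bar>ln B\<bar> + 2)"
          by (simp add: abs_mult flip: right_diff_distrib)
        with bd(2) have "\<bar>ln (det_moment N k) - (real k)\<^sup>2 * B\<bar> \<le> (real k)\<^sup>2 * (\<bar>ln B\<bar> + 4)"
          by (simp add: distrib_left)
        also have "\<dots> \<le> (4 * q)\<^sup>2 * (\<bar>ln B\<bar> + 4)"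
          using k kp by (intro mult_right_mono power_mono) auto
        also have "\<dots> = q\<^sup>2 * (16 * (\<bar>ln B\<bar> + 4))" by (simp add: power_mult_distrib)
        also have "\<dots> \<le> q\<^sup>2 * (s * B)" using B0[OF B1(2)] by (intro mult_left_mono) auto
        finally show ?thesis using bd(1) by (simp add: mult_ac)
      qed
      have lnk: "ln (real (k * N + 1)) \<le> s * (q\<^sup>2 * B)" if "real k \<le> q" for k
      proof -
        have kN: "k \<le> N" using that q8 q1 by linarith
        have "k * N + 1 \<le> N ^ 3"
        proof -
          have "k * N + 1 \<le> N * N + N * N" using kN elim(6) by (intro add_mono mult_right_mono) auto
          also have "\<dots> = 2 * (N * N)" by simp
          also have "\<dots> \<le> N * (N * N)" using elim(6) by (intro mult_right_mono) auto
          finally show ?thesis by (simp add: power3_eq_cube mult_ac)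
        qed
        then have "real (k * N + 1) \<le> real N ^ 3" by (metis of_nat_le_iff of_nat_power)
        then have "ln (real (k * N + 1)) \<le> ln (real N ^ 3)"
          using ln_le_cancel_iff[of "real (k * N + 1)" "real N ^ 3"] N3 by (simp add: add_pos_nonneg)
        also have "\<dots> = 3 * L" using N3 by (simp add: ln_realpow L_def)
        finally show ?thesis using sA by simp
      qed
      show ?case using Bp sq sA L G lnk by auto
    qed
  qed
qed

section \<open>The tail asymptotics, uniformly in the exponent\<close>

text \<open>Specialises the optimisation to the determinant moments, with
  \<open>q = N powr lam / B\<close>: then \<open>q * B\<close> is the logarithmic level
  \<open>N powr lam\<close> and \<open>q\<^sup>2 * B\<close> is \<open>A\<close>.\<close>

lemma max_Lambda_tail_bounds:
  fixes \<delta> \<eta> :: real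
  assumes \<delta>: "0 < \<delta>" and \<mu>: "\<forall>N\<ge>1. haar_unitary N (\<mu> N)" and \<eta>: "0 < \<eta>" "\<eta> \<le> 1"
  shows "\<forall>\<^sub>F N in sequentially. \<forall>lam\<in>{\<delta>..1 - \<delta>}. \<forall>A P.
    A = real N powr (2 * lam) / ((1 - lam) * ln (real N)) \<longrightarrow>
    P = \<P>(U in \<mu> N. max_Lambda U \<ge> exp (real N powr lam)) \<longrightarrow>
    0 < A \<and> exp (- A * (1 + 10 * \<eta>)) \<le> P \<and> P \<le> exp (- A * (1 - 10 * \<eta>))"
proof -
  have "0 < \<eta>\<^sup>2 / 12" using \<eta> by simp
  from eventually_moment_regime[OF \<delta> this] eventually_ge_at_top[of 1] show ?thesis
  proof eventually_elim
    case (elim N)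
    have H: "haar M (\<mu> M)" if "M \<ge> 1" for M using \<mu> that by (simp add: haar_def)
    interpret haar N "\<mu> N" using H elim by simp
    obtain n where n: "N = Suc n" using elim not0_implies_Suc by fastforce
    have M: "(\<integral>\<^sup>+U. ennreal (cmod (Lambda U \<theta>) ^ (2 * k)) \<partial>\<mu> N) = ennreal (det_moment N k)" for \<theta> k
      using nn_integral_Lambda[of \<theta> "2 * k"] nn_integral_det_moment[of \<mu> n k] H by (simp add: n)
    show ?case
    proof (intro ballI allI impI, goal_cases)
      case (1 lam A P)
      define B where "B = (1 - lam) * ln (real N)"
      define q where "q = real N powr lam / B"
      note reg = elim(1)[rule_format, OF 1(1) B_def q_def]
      have B: "0 < B" and q: "1 \<le> \<eta>\<^sup>2 / 12 * q" and s2: "2 \<le> \<eta>\<^sup>2 / 12 * (q\<^sup>2 * B)"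
        using reg \<eta> by auto
      have x: "q * B = real N powr lam" using B by (simp add: q_def)
      have A: "A = q\<^sup>2 * B"
      proof -
        have "q\<^sup>2 * B = (real N powr lam)\<^sup>2 / B" using B by (simp add: q_def power2_eq_square)
        also have "(real N powr lam)\<^sup>2 = real N powr (2 * lam)"
          by (simp only: power2_eq_square mult_2 powr_add)
        finally show ?thesis by (simp add: 1(2) B_def)
      qed
      have "0 < A"
      proof -
        have "q \<noteq> 0" using q by auto
        then show ?thesis using B by (simp add: A)
      qed
      have upper: "P \<le> real (k * N + 1) * det_moment N k * exp (- 2 * real k * (q * B))" for k
        unfolding x 1(3) by (rule prob_max_Lambda_le[OF M])
      have lower: "det_moment N k \<le> exp (2 * real h * (q * B)) * det_moment N (k - h) +
          exp (- 2 * real h * y) * det_moment N (k + h) + exp (2 * real k * y) * P" if "h \<le> k" for k h y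
        unfolding x 1(3) by (rule prob_max_Lambda_ge[OF M that])
      have G: "0 < det_moment N k \<and> \<bar>ln (det_moment N k) - (real k)\<^sup>2 * B\<bar> \<le> \<eta>\<^sup>2 / 12 * (q\<^sup>2 * B)"
        if "q / 2 \<le> real k" "real k \<le> 4 * q" for k
        using reg that by blast
      have L: "ln (real (k * N + 1)) \<le> \<eta>\<^sup>2 / 12 * (q\<^sup>2 * B)" if "real k \<le> q" for k
        using reg that by blast
      note tail_bounds_of_moment_bounds[OF \<eta> refl B q s2 G L upper lower]
      then have "exp (- (q\<^sup>2 * B) * (1 + 10 * \<eta>)) \<le> P" "P \<le> exp (- (q\<^sup>2 * B) * (1 - 10 * \<eta>))"
        by blast+
      with \<open>0 < A\<close> show ?case by (simp add: A)
    qed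
  qed
qed

theorem lemmaA1:
  fixes \<delta> :: real and \<mu> :: "nat \<Rightarrow> complex mat measure"
  assumes "\<delta> > 0"
    and "\<And>N. N \<ge> 1 \<Longrightarrow> haar_unitary N (\<mu> N)"
  shows "\<exists>\<epsilon> :: nat \<Rightarrow> real \<Rightarrow> real.
    uniform_limit {\<delta>..1 - \<delta>} \<epsilon> (\<lambda>_. 0) sequentially \<and>
    (\<forall>\<^sub>F N in sequentially. \<forall>lam\<in>{\<delta>..1 - \<delta>}.
      \<P>(U in \<mu> N. max_Lambda U \<ge> exp (real N powr lam)) =
        exp (- (real N powr (2 * lam) / ((1 - lam) * ln (real N))) * (1 + \<epsilon> N lam)))"
proof -
  define A where "A N lam = real N powr (2 * lam) / ((1 - lam) * ln (real N))" for N :: nat and lam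
  define P where "P N lam = \<P>(U in \<mu> N. max_Lambda U \<ge> exp (real N powr lam))" for N lam
  \<comment> \<open>Solved from the claimed equation, which therefore holds once the probability and
    \<open>A N lam\<close> are positive; the content is the uniform convergence.\<close>
  define \<epsilon> where "\<epsilon> N lam = - ln (P N lam) / A N lam - 1" for N lam
  have "\<forall>N\<ge>1. haar_unitary N (\<mu> N)" using assms(2) by simp
  note bounds = max_Lambda_tail_bounds[OF assms(1) this]
  have "uniform_limit {\<delta>..1 - \<delta>} \<epsilon> (\<lambda>_. 0) sequentially"
    unfolding uniform_limit_iff
  proof (intro allI impI)
    fix e :: real assume e: "e > 0"
    \<comment> \<open>The cap \<open>1\<close> makes the tail bounds applicable, and
      \<open>e / 20\<close> turns their error \<open>10 * \<eta>\<close> into at most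
      \<open>e / 2\<close>.\<close>
    define \<eta> where "\<eta> = min 1 (e / 20)"
    have \<eta>: "0 < \<eta>" "\<eta> \<le> 1" "10 * \<eta> < e" using e by (auto simp: \<eta>_def)
    show "\<forall>\<^sub>F N in sequentially. \<forall>lam\<in>{\<delta>..1 - \<delta>}. dist (\<epsilon> N lam) 0 < e"
      using bounds[OF \<eta>(1,2)]
    proof eventually_elim
      case (elim N)
      show ?case
      proof
        fix lam assume "lam \<in> {\<delta>..1 - \<delta>}"
        from elim[rule_format, OF this A_def P_def]
        have A: "0 < A N lam" and P: "exp (- A N lam * (1 + 10 * \<eta>)) \<le> P N lam" "P N lam \<le> exp (- A N lam * (1 - 10 * \<eta>))"
          by auto
        from P(1) have "0 < P N lam" using exp_gt_zero less_le_trans by blast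
        then have "- A N lam * (1 + 10 * \<eta>) \<le> ln (P N lam)" "ln (P N lam) \<le> - A N lam * (1 - 10 * \<eta>)"
          using P by (metis exp_le_cancel_iff exp_ln)+
        then have "\<bar>\<epsilon> N lam\<bar> \<le> 10 * \<eta>"
          using A by (simp add: \<epsilon>_def abs_le_iff field_simps)
        then show "dist (\<epsilon> N lam) 0 < e" using \<eta>(3) by simp
      qed
    qed
  qed
  \<comment> \<open>For the equation only positivity is wanted, so the coarse accuracy
    \<open>\<eta> = 1\<close> is enough.\<close>
  moreover have one: "0 < (1 :: real)" "(1 :: real) \<le> 1" by simp_all
  have "\<forall>\<^sub>F N in sequentially. \<forall>lam\<in>{\<delta>..1 - \<delta>}. P N lam = exp (- A N lam * (1 + \<epsilon> N lam))"
    using bounds[OF one]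
  proof eventually_elim
    case (elim N)
    show ?case
    proof
      fix lam assume "lam \<in> {\<delta>..1 - \<delta>}"
      from elim[rule_format, OF this A_def P_def]
      have A: "0 < A N lam" and "exp (- A N lam * (1 + 10 * 1)) \<le> P N lam" by auto
      then have "0 < P N lam" using exp_gt_zero less_le_trans by blast
      moreover have "- A N lam * (1 + \<epsilon> N lam) = ln (P N lam)" using A by (simp add: \<epsilon>_def)
      ultimately show "P N lam = exp (- A N lam * (1 + \<epsilon> N lam))" by simp
    qed
  qed
  ultimately show ?thesis unfolding A_def P_def by blast
qed

end
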